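(* Let $G$ be a connected, cellularly embedded graph, and let $A\subseteq E(G)$, with $A^c=E(G)\setminus A$ and $A^{*}=\{e^*: e\in A\}\subseteq E(G^* )$. Then \[ [ (G\cup G^{*}) - (A^c \cup A^{*} ) ]^{\circledast} \cong G^A, \] where $G\cup G^{*}$ has the standard immersion and $\cong$ denotes equivalence as abstract graphs.
   Context: Graphs are finite and may have loops and multiple edges. An embedded graph is a graph drawn on a surface $\Sigma$ (not necessarily orientable) with edges meeting only at their ends; its regions are the components of the complement; it is cellularly embedded if each region is an open disc (then called a face). For a cellularly embedded $G\subset\Sigma$, the geometric dual $G^*\subset\Sigma$ has one vertex in each face of $G$ and, for each edge $e$ of $G$, an edge $e^*$ crossing $e$ once and joining the vertices in the face(s) on the two sides of $e$. The standard immersion of $G\cup G^*$ in $\Sigma$ is the one in which each edge $e$ of $G$ meets exactly one edge of $G^*$, namely $e^*$, at exactly one point. The expression $(G\cup G^{*}) - (A^c \cup A^{*})$ means delete from this immersed graph the edges of $G$ in $A^c$ and the edges of $G^*$ in $A^*$, keeping all vertices; the result is a graph embedded (not necessarily cellularly) in $\Sigma$. For a not necessarily cellularly embedded graph $H\subset\Sigma$, $H^{\circledast}$ is the embedded graph formed in the same way as the geometric dual but with one vertex in each region of $H$: for each edge of $H$ there is one edge of $H^{\circledast}$ crossing it and joining the vertices in the region(s) on its two sides. (Its embedding is not unique, but this causes no problems.) Two embedded graphs satisfy $G_1\cong G_2$ (equivalent as abstract graphs) if their underlying abstract graphs are isomorphic. Partial duals. A ribbon graph $G=(V(G),E(G))$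 is a (possibly non-orientable) surface with boundary, represented as the union of a set $V(G)$ of discs (vertices) and a set $E(G)$ of discs (edges) such that vertices and edges meet in disjoint line segments, each such segment lies on the boundary of exactly one vertex and exactly one edge, and every edge contains exactly two such segments. Ribbon graphs are equivalent to cellularly embedded graphs (take a neighbourhood of the embedded graph; conversely, glue discs to the boundary components), and one moves freely between them. The geometric dual of a ribbon graph $G$ is $G^*=(V(G^* ),E(G))$, where $V(G^* )$ is a set of discs filling in the boundary components of $G$. An arrow-marked ribbon graph is a ribbon graph with coloured arrows on the boundaries of its vertices, disjoint from the edges, with exactly two arrows of each colour. For $B\subseteq E(G)$, $G\,\vec{-}\,B$ is the arrow-marked ribbon graph obtained by, for each $e\in B$, orienting the boundary of $e$ arbitrarily, placing on each of the two arcs where $e$ meets vertices an arrow coloured $e$ following this orientation, and deleting $e$. Conversely, if $H$ is an arrow-marked ribbon graph with label set $B$, $H\,\vec{+}\,B$ is obtained by, for each $e\in B$, taking a disc with oriented boundary and identifying two disjoint arcs of its boundary with the two arrows coloured $e$ consistently with the orientation; the disc becomes an edge $e$. The geometric dual of an arrow-marked ribbon graph is the geometric dual of the underlying ribbon graph with the inherited marking arrows. The partial dual is $G^A:=(G\,\vec{-}\,A^c)^*\,\vec{+}\,A^c$. *)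

theory Defs
  imports "HOL-Analysis.Analysis"
begin

section \<open>Abstract graphs\<close>

text \<open>
  Multigraphs with loops: an edge has a set of ends, which is a singleton exactly for a loop.
\<close>

record ('v, 'e) graph =
  verts :: "'v set"
  edges :: "'e set"
  ends :: "'e \<Rightarrow> 'v set"

definition graph_iso :: "('v, 'e) graph \<Rightarrow> ('w, 'f) graph \<Rightarrow> bool" where
  "graph_iso G H \<longleftrightarrow>
     (\<exists>f g. bij_betw f (verts G) (verts H) \<and> bij_betw g (edges G) (edges H) \<and>
            (\<forall>e\<in>edges G. ends H (g e) = f ` ends G e))"

definition connected_graph :: "('v, 'e) graph \<Rightarrow> bool" where
  "connected_graph G \<longleftrightarrow>
     verts G \<noteq> {} \<and>
     (\<forall>u\<in>verts G. \<forall>v\<in>verts G. (u, v) \<in> {(x, y). \<exists>e\<in>edges G. ends G e = {x, y}}\<^sup>*)"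


section \<open>Graphs embedded in surfaces\<close>

text \<open>
  Surfaces are closed surfaces, orientable or not, given as subsets of an arbitrary Hausdorff
  space.  Compactness is no restriction for cellularly embedded finite graphs.
\<close>

definition surface :: "'a::t2_space set \<Rightarrow> bool" where
  "surface S \<longleftrightarrow>
     compact S \<and>
     (\<forall>x\<in>S. \<exists>U. openin (top_of_set S) U \<and> x \<in> U \<and> U homeomorphic (ball 0 1 :: complex set))"

text \<open>A drawn graph: vertices are points of the surface, every edge is drawn as a curve.\<close>

record ('a, 'e) drawing =
  points :: "'a set"
  lines :: "'e set"
  curve :: "'e \<Rightarrow> real \<Rightarrow> 'a"

definition inner :: "(real \<Rightarrow> 'a) \<Rightarrow> 'a set" where
  "inner g = g ` {0<..<1}"

definition carrier :: "('a::t2_space, 'e) drawing \<Rightarrow> 'a set" where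
  "carrier G = points G \<union> (\<Union>e\<in>lines G. path_image (curve G e))"

definition abstract_graph :: "('a::t2_space, 'e) drawing \<Rightarrow> ('a, 'e) graph" where
  "abstract_graph G =
     \<lparr>verts = points G, edges = lines G,
      ends = (\<lambda>e. {pathstart (curve G e), pathfinish (curve G e)})\<rparr>"

definition embedded :: "'a::t2_space set \<Rightarrow> ('a, 'e) drawing \<Rightarrow> bool" where
  "embedded S G \<longleftrightarrow>
     finite (points G) \<and> finite (lines G) \<and> points G \<subseteq> S \<and>
     (\<forall>e\<in>lines G. simple_path (curve G e) \<and> path_image (curve G e) \<subseteq> S \<and>
        pathstart (curve G e) \<in> points G \<and> pathfinish (curve G e) \<in> points G \<and>
        inner (curve G e) \<inter> points G = {}) \<and>
     (\<forall>e\<in>lines G. \<forall>e'\<in>lines G. e \<noteq> e' \<longrightarrow> inner (curve G e) \<inter> inner (curve G e') = {})"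

definition regions :: "'a::t2_space set \<Rightarrow> ('a, 'e) drawing \<Rightarrow> 'a set set" where
  "regions S G = components (S - carrier G)"

definition cellularly_embedded :: "'a::t2_space set \<Rightarrow> ('a, 'e) drawing \<Rightarrow> bool" where
  "cellularly_embedded S G \<longleftrightarrow>
     embedded S G \<and> (\<forall>F\<in>regions S G. F homeomorphic (ball 0 1 :: complex set))"

text \<open>\<open>X\<close> and \<open>Y\<close> cross at \<open>x\<close>: in a suitable chart they are the two coordinate axes.\<close>

definition cross_at :: "'a::t2_space set \<Rightarrow> 'a set \<Rightarrow> 'a set \<Rightarrow> 'a \<Rightarrow> bool" where
  "cross_at S X Y x \<longleftrightarrow>
     (\<exists>U h k. openin (top_of_set S) U \<and> x \<in> U \<and>
        homeomorphism U (ball 0 1 :: complex set) h k \<and> h x = 0 \<and>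
        h ` (U \<inter> X) = {z \<in> ball 0 1. Im z = 0} \<and>
        h ` (U \<inter> Y) = {z \<in> ball 0 1. Re z = 0})"

text \<open>
  \<open>region_dual S H K\<close>: the embedded graph \<open>K\<close> has one vertex in each region of \<open>H\<close>, and for each
  edge \<open>e\<close> of \<open>H\<close> one edge, with the same label, that meets \<open>H\<close> in a single point, where it
  crosses \<open>e\<close>; its ends therefore are the vertices in the regions on the two sides of \<open>e\<close>.  If
  \<open>H\<close> is cellularly embedded then \<open>K\<close> is its geometric dual, and the drawing of the two graphs
  together is the standard immersion.
\<close>

definition region_dual ::
  "'a::t2_space set \<Rightarrow> ('a, 'e) drawing \<Rightarrow> ('a, 'e) drawing \<Rightarrow> bool" where
  "region_dual S H K \<longleftrightarrow>
     embedded S K \<and>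
     points K \<subseteq> \<Union>(regions S H) \<and> (\<forall>F\<in>regions S H. \<exists>!v. v \<in> points K \<inter> F) \<and>
     lines K = lines H \<and>
     (\<forall>e\<in>lines H. \<exists>x\<in>inner (curve H e).
        path_image (curve K e) \<inter> carrier H = {x} \<and>
        cross_at S (path_image (curve H e)) (path_image (curve K e)) x)"

text \<open>The immersed union of two drawn graphs; the edges \<open>e\<close> and \<open>e\<^sup>*\<close> are \<open>Inl e\<close> and \<open>Inr e\<close>.\<close>

definition immersed_union ::
  "('a::t2_space, 'e) drawing \<Rightarrow> ('a, 'f) drawing \<Rightarrow> ('a, 'e + 'f) drawing" where
  "immersed_union G H =
     \<lparr>points = points G \<union> points H, lines = lines G <+> lines H,
      curve = case_sum (curve G) (curve H)\<rparr>"

definition delete_lines :: "('a, 'e) drawing \<Rightarrow> 'e set \<Rightarrow> ('a, 'e) drawing" where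
  "delete_lines G X = G\<lparr>lines := lines G - X\<rparr>"


section \<open>Arrow-marked ribbon graphs\<close>

text \<open>
  On the boundary of the vertex discs lie disjoint line segments: those where edge discs are
  attached, and the marking arrows.  The end points of these segments are the \<^emph>\<open>corners\<close>; the
  surface is determined up to homeomorphism by the way its boundary arcs join them.

  \<^item> \<open>seg q\<close> is the other end of the segment that ends at \<open>q\<close>.
  \<^item> \<open>gap q\<close> is the other end of the free arc, on the boundary of the vertex disc, that ends at
    \<open>q\<close>.  So the boundary of a vertex disc is a cycle in which \<open>seg\<close> and \<open>gap\<close> alternate; a
    vertex disc without segments has no corners.
  \<^item> \<open>side q\<close> is, if the segment at \<open>q\<close> belongs to an edge disc, the other end of the free arc of
    the boundary of that edge disc that ends at \<open>q\<close>.  So the boundary of an edge disc is a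
    4-cycle in which \<open>seg\<close> and \<open>side\<close> alternate.  On arrows \<open>side\<close> has no meaning.
  \<^item> \<open>label q\<close> is the edge or the colour of the arrow at \<open>q\<close>; an arrow points from a corner in
    \<open>tails\<close> to a corner outside \<open>tails\<close>.
\<close>

record ('v, 'e, 'q) ribbon =
  discs :: "'v set"
  bands :: "'e set"
  colours :: "'e set"
  corners :: "'q set"
  disc_of :: "'q \<Rightarrow> 'v"
  label :: "'q \<Rightarrow> 'e"
  seg :: "'q \<Rightarrow> 'q"
  gap :: "'q \<Rightarrow> 'q"
  side :: "'q \<Rightarrow> 'q"
  tails :: "'q set"

definition matching :: "'q set \<Rightarrow> ('q \<Rightarrow> 'q) \<Rightarrow> bool" where
  "matching Q f \<longleftrightarrow> (\<forall>q\<in>Q. f q \<in> Q \<and> f q \<noteq> q \<and> f (f q) = q)"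

definition circle :: "('q \<Rightarrow> 'q) \<Rightarrow> ('q \<Rightarrow> 'q) \<Rightarrow> 'q \<Rightarrow> 'q set" where
  "circle f g q = {p. (q, p) \<in> {(x, y). y = f x \<or> y = g x}\<^sup>*}"

definition corners_on :: "('v, 'e, 'q) ribbon \<Rightarrow> 'e set \<Rightarrow> 'q set" where
  "corners_on R B = {q \<in> corners R. label R q \<in> B}"

text \<open>Every edge has two segments and every colour two arrows, hence the four corners.\<close>

definition arrow_marked_ribbon_graph :: "('v, 'e, 'q) ribbon \<Rightarrow> bool" where
  "arrow_marked_ribbon_graph R \<longleftrightarrow>
     finite (discs R) \<and> finite (bands R) \<and> finite (colours R) \<and> finite (corners R) \<and>
     bands R \<inter> colours R = {} \<and>
     (\<forall>q\<in>corners R. disc_of R q \<in> discs R \<and> label R q \<in> bands R \<union> colours R) \<and>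
     (\<forall>e\<in>bands R \<union> colours R. card (corners_on R {e}) = 4) \<and>
     matching (corners R) (seg R) \<and> matching (corners R) (gap R) \<and>
     (\<forall>p\<in>corners R. \<forall>q\<in>corners R.
        disc_of R p = disc_of R q \<longleftrightarrow> q \<in> circle (seg R) (gap R) p) \<and>
     (\<forall>q\<in>corners R. label R (seg R q) = label R q) \<and>
     matching (corners_on R (bands R)) (side R) \<and>
     (\<forall>q\<in>corners_on R (bands R). label R (side R q) = label R q \<and> side R q \<noteq> seg R q) \<and>
     tails R \<subseteq> corners_on R (colours R) \<and>
     (\<forall>q\<in>corners_on R (colours R). seg R q \<in> tails R \<longleftrightarrow> q \<notin> tails R)"

definition ribbon_graph :: "('v, 'e, 'q) ribbon \<Rightarrow> bool" where
  "ribbon_graph R \<longleftrightarrow> arrow_marked_ribbon_graph R \<and> colours R = {}"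

definition underlying_graph :: "('v, 'e, 'q) ribbon \<Rightarrow> ('v, 'e) graph" where
  "underlying_graph R =
     \<lparr>verts = discs R, edges = bands R, ends = (\<lambda>e. disc_of R ` corners_on R {e})\<rparr>"

text \<open>
  The boundary of the surface alternately follows free arcs of vertex discs, and free arcs of
  edge discs or marking arrows, the latter being \<open>bside\<close>.  A boundary component is represented by
  the corners on it, or by the vertex disc that it bounds if it has no corners.
\<close>

definition bside :: "('v, 'e, 'q) ribbon \<Rightarrow> 'q \<Rightarrow> 'q" where
  "bside R q = (if label R q \<in> bands R then side R q else seg R q)"

definition boundary_components :: "('v, 'e, 'q) ribbon \<Rightarrow> ('q set + 'v) set" where
  "boundary_components R =
     circle (bside R) (gap R) ` corners R <+> (discs R - disc_of R ` corners R)"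

text \<open>
  In the dual the vertex discs fill the boundary components.  The edge discs, which are kept, are
  attached to them along their formerly free sides, and the segments that joined them to the old
  vertex discs become free.  The arrows are inherited.
\<close>

definition ribbon_dual :: "('v, 'e, 'q) ribbon \<Rightarrow> ('q set + 'v, 'e, 'q) ribbon" where
  "ribbon_dual R =
     \<lparr>discs = boundary_components R, bands = bands R, colours = colours R, corners = corners R,
      disc_of = (\<lambda>q. Inl (circle (bside R) (gap R) q)), label = label R,
      seg = bside R, gap = gap R, side = seg R, tails = tails R\<rparr>"

text \<open>
  An orientation of the boundaries of the edge discs in \<open>B\<close>, given by the corners at which the
  boundary enters a segment shared with a vertex disc: walking along the oriented boundary it
  alternately enters and leaves such segments.
\<close>

definition boundary_orientation :: "('v, 'e, 'q) ribbon \<Rightarrow> 'e set \<Rightarrow> 'q set \<Rightarrow> bool" where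
  "boundary_orientation R B D \<longleftrightarrow>
     D \<subseteq> corners_on R B \<and>
     (\<forall>q\<in>corners_on R B. (seg R q \<in> D \<longleftrightarrow> q \<notin> D) \<and> (side R q \<in> D \<longleftrightarrow> q \<notin> D))"

text \<open>Deletion of \<open>B\<close> forgets \<open>side\<close>, and keeps the arrows determined by the orientation \<open>D\<close>.\<close>

definition arrow_delete ::
  "('v, 'e, 'q) ribbon \<Rightarrow> 'e set \<Rightarrow> 'q set \<Rightarrow> ('v, 'e, 'q) ribbon" where
  "arrow_delete R B D =
     R\<lparr>bands := bands R - B, colours := colours R \<union> B,
       side := (\<lambda>q. if label R q \<in> B then undefined else side R q), tails := tails R \<union> D\<rparr>"

text \<open>
  When an edge disc is attached along the two arrows of a colour, its oriented boundary runs
  along one arrow, then along a free arc from its head to the tail of the other arrow, then along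
  that arrow and back; so \<open>side\<close> joins each head to the tail of the other arrow.
\<close>

definition arrow_add :: "('v, 'e, 'q) ribbon \<Rightarrow> 'e set \<Rightarrow> ('v, 'e, 'q) ribbon" where
  "arrow_add R B =
     R\<lparr>bands := bands R \<union> B, colours := colours R - B,
       side := (\<lambda>q. if label R q \<in> B
                    then THE p. p \<in> corners_on R {label R q} \<and> p \<noteq> q \<and> p \<noteq> seg R q \<and>
                                (p \<in> tails R \<longleftrightarrow> q \<notin> tails R)
                    else side R q),
       tails := tails R - corners_on R B\<rparr>"

definition partial_dual ::
  "('v, 'e, 'q) ribbon \<Rightarrow> 'e set \<Rightarrow> 'q set \<Rightarrow> ('q set + 'v, 'e, 'q) ribbon" where
  "partial_dual R A D =
     arrow_add (ribbon_dual (arrow_delete R (bands R - A) D)) (bands R - A)"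


section \<open>The ribbon graph of a cellularly embedded graph\<close>

text \<open>
  Glue face discs to the boundary components of a ribbon graph, draw every edge along the core of
  its band, and every dual edge across the band.  With the centres of the vertex discs, bands and
  face discs as vertices this gives the barycentric subdivision of the cell decomposition: there
  is one triangle for each corner \<open>q\<close>, with vertices in the vertex disc, the band, and the face
  disc that meet at \<open>q\<close>.  Two triangles share half of an edge if their corners are joined by
  \<open>seg\<close>, half of a dual edge if they are joined by \<open>side\<close>, and a line from a vertex to a face if
  they are joined by \<open>gap\<close>; they share a vertex if their corners lie on the same disc, band, or
  boundary component.  In barycentric coordinates \<open>(a, b, c)\<close> the three weights belong to the
  vertex, the edge and the face, in this order.
\<close>

definition triangle :: "(real \<times> real \<times> real) set" where
  "triangle = {(a, b, c). a \<ge> 0 \<and> b \<ge> 0 \<and> c \<ge> 0 \<and> a + b + c = 1}"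

definition glued :: "('v, 'e, 'q) ribbon \<Rightarrow> 'q \<Rightarrow> 'q \<Rightarrow> real \<times> real \<times> real \<Rightarrow> bool" where
  "glued R p q = (\<lambda>(a, b, c).
     p = q \<or>
     c = 0 \<and> q = seg R p \<or> a = 0 \<and> q = side R p \<or> b = 0 \<and> q = gap R p \<or>
     a = 1 \<and> disc_of R p = disc_of R q \<or>
     b = 1 \<and> label R p = label R q \<or>
     c = 1 \<and> q \<in> circle (side R) (gap R) p)"

text \<open>
  \<open>ribbon_graph_of S G G' R\<close>: the ribbon graph \<open>R\<close> is a neighbourhood of \<open>G\<close> in \<open>S\<close>, where \<open>G'\<close> is
  the geometric dual of \<open>G\<close> in the standard immersion.  If \<open>G\<close> has no edges then \<open>R\<close> is a set of
  discs without corners, and the triangles do not cover \<open>S\<close>.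
\<close>

definition ribbon_graph_of ::
  "'a::t2_space set \<Rightarrow> ('a, 'e) drawing \<Rightarrow> ('a, 'e) drawing \<Rightarrow> ('a, 'e, 'q) ribbon \<Rightarrow> bool" where
  "ribbon_graph_of S G G' R \<longleftrightarrow>
     ribbon_graph R \<and> discs R = points G \<and> bands R = lines G \<and>
     (\<exists>T :: 'q \<Rightarrow> real \<times> real \<times> real \<Rightarrow> 'a.
        (\<forall>q\<in>corners R. continuous_on triangle (T q) \<and> T q ` triangle \<subseteq> S) \<and>
        (corners R \<noteq> {} \<longrightarrow> S = (\<Union>q\<in>corners R. T q ` triangle)) \<and>
        (\<forall>p\<in>corners R. \<forall>q\<in>corners R. \<forall>x\<in>triangle. \<forall>y\<in>triangle.
           T p x = T q y \<longleftrightarrow> x = y \<and> glued R p q x) \<and>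
        (\<forall>q\<in>corners R. T q (1, 0, 0) = disc_of R q \<and> T q (0, 0, 1) \<in> points G') \<and>
        (\<forall>e\<in>lines G.
           path_image (curve G e) =
             (\<Union>q\<in>corners_on R {e}. T q ` {(a, b, c) \<in> triangle. c = 0}) \<and>
           path_image (curve G' e) =
             (\<Union>q\<in>corners_on R {e}. T q ` {(a, b, c) \<in> triangle. a = 0})))"

end

theory Submission
  imports Defs
begin

text \<open>
  The right-hand graph is combinatorial: deleting \<open>A\<^sup>c\<close> from the ribbon graph, dualising and adding
  \<open>A\<^sup>c\<close> again gives one vertex for each orbit of corners under \<open>gap\<close> and the map that is \<open>side\<close>
  on edges in \<open>A\<close> and \<open>seg\<close> on the others (lemma \<open>underlying_partial_dual\<close>), and an edge \<open>e\<close>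
  joins the orbits of the corners labelled \<open>e\<close>.

  The left-hand graph has the same description.  In the barycentric subdivision, with one triangle
  for each corner, \<open>seg\<close>, \<open>side\<close> and \<open>gap\<close> say which triangles share half of an edge, half of a
  dual edge, or a line from a vertex to a face.  The graph \<open>(G \<union> G\<^sup>*) - (A\<^sup>c \<union> A\<^sup>*)\<close> runs along
  exactly one side of each triangle: the \<open>seg\<close> side for labels in \<open>A\<close>, the \<open>side\<close> side for all
  others; it also contains all three corners of the triangle.  Cutting the surface along it
  therefore leaves the triangles glued along the two remaining sides, so the regions are the orbits
  above (\<open>components_complement\<close>).

  It remains to see that the edge of the dual that crosses \<open>e\<close> joins the right regions
  (\<open>crossing_ends\<close>).  Near the crossing there are only triangles labelled \<open>e\<close>, and these lie in
  at most two orbits, one on each side of \<open>e\<close>.  Both halves of the crossing curve run into these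
  orbits; if they run into the same one, then a chart in which the two curves are the coordinate
  axes shows that both half discs at the crossing lie in that region, so the two orbits coincide.

  Two points need care.  A vertex of \<open>G\<close> that is not a corner of any triangle would give the partial dual an
  additional vertex.  There is none since \<open>G\<close> is connected: such a vertex would be an end of an
  edge whose image is a circle through one single disc centre, although an arc, unlike a circle,
  is disconnected by the removal of an inner point (\<open>vertex_has_corner\<close>).  If \<open>G\<close> has no edges
  there are no triangles at all; then the surface is an open disc and a point, and both graphs
  consist of one vertex (\<open>edgeless_case\<close>).
\<close>

section \<open>Connected components and boundary circles\<close>

text \<open>
  In a finite partition into closed sets every part is open as well, so connected parts are
  components.
\<close>

lemma components_eq_finite_partition:
  assumes "finite F" and union: "\<Union>F = X" and disj: "pairwise disjnt F"
    and F: "\<And>C. C \<in> F \<Longrightarrow> C \<noteq> {} \<and> connected C \<and> closedin (top_of_set X) C"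
  shows "components X = F"
proof -
  have comp: "C \<in> components X" if "C \<in> F" for C
    unfolding in_components_maximal
  proof (intro conjI allI impI)
    show "C \<noteq> {}" "C \<subseteq> X" "connected C"
      using F that union by auto
    fix D assume D: "D \<noteq> {} \<and> C \<subseteq> D \<and> D \<subseteq> X \<and> connected D"
    define rest where "rest = \<Union>(F - {C})"
    have cl: "closedin (top_of_set X) C" "closedin (top_of_set X) rest"
      using F that \<open>finite F\<close> unfolding rest_def by (auto intro!: closedin_Union)
    have "C \<inter> rest = {}"
      using disj that unfolding rest_def by (fastforce simp: pairwise_def disjnt_def)
    moreover have "D \<subseteq> C \<union> rest"
      using D union that unfolding rest_def by auto
    moreover have "closedin (top_of_set D) (D \<inter> E)" if E: "closedin (top_of_set X) E" for E
    proof -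
      obtain K where "closed K" "E = X \<inter> K"
        using E by (auto simp: closedin_closed)
      moreover from this have "D \<inter> E = D \<inter> K"
        using D by auto
      ultimately show ?thesis
        by (simp add: closedin_closed_Int)
    qed
    ultimately have "\<not> connected D" if "D \<inter> C \<noteq> {}" "D \<inter> rest \<noteq> {}"
      using cl that unfolding connected_closedin not_not
      by (intro exI[of _ "D \<inter> C"] exI[of _ "D \<inter> rest"]) auto
    then have "D \<inter> C = {} \<or> D \<inter> rest = {}"
      using D by blast
    moreover have "D \<subseteq> C \<union> rest"
      using D union that unfolding rest_def by auto
    ultimately show "D = C"
      using D \<open>C \<noteq> {}\<close> by blast
  qed
  moreover have "D \<in> F" if D: "D \<in> components X" for D
  proof -
    obtain y where "y \<in> D" "y \<in> X"
      using in_components_nonempty[OF D] in_components_subset[OF D] by blast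
    then obtain C where "C \<in> F" "y \<in> C"
      using union by blast
    then show ?thesis
      using components_eq[OF D comp[OF \<open>C \<in> F\<close>]] \<open>y \<in> D\<close> by auto
  qed
  ultimately show ?thesis by blast
qed

text \<open>
  Both maps are involutions, so reachability along them is symmetric and the circles partition
  the corners.
\<close>

lemma circle_equiv:
  assumes "matching Q f" "matching Q g" "q \<in> Q" "p \<in> circle f g q"
  shows "p \<in> Q" and "circle f g p = circle f g q"
proof -
  let ?r = "{(x, y). y = f x \<or> y = g x}"
  have "p \<in> Q \<and> (p, q) \<in> ?r\<^sup>*"
    using assms(4) unfolding circle_def mem_Collect_eq
  proof (induction rule: rtrancl_induct)
    case base
    then show ?case using assms by simp
  next
    case (step y z)
    then have "z \<in> Q" "(z, y) \<in> ?r"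
      using assms(1,2) unfolding matching_def by auto
    then show ?case
      using step by (meson converse_rtrancl_into_rtrancl)
  qed
  then show "p \<in> Q" "circle f g p = circle f g q"
    using assms(4) unfolding circle_def by (auto intro: rtrancl_trans)
qed

lemma circle_refl: "q \<in> circle f g q"
  by (simp add: circle_def)

lemma circle_step: "f q \<in> circle f g q" "g q \<in> circle f g q"
  by (auto simp: circle_def)

section \<open>Cutting a triangulated surface along edges and dual edges\<close>

text \<open>
  Fix the set \<open>A\<close> of edges along which the surface is cut; for the other edges it is cut along the
  dual edge.  Across \<open>open_side\<close> the triangle of \<open>q\<close> remains joined to its neighbour, across
  \<open>cut_side\<close> it is separated from it.  These two maps are \<open>side\<close> and \<open>seg\<close>, in an order that
  depends on the label of \<open>q\<close>.
\<close>

definition open_side :: "('v, 'e, 'q) ribbon \<Rightarrow> 'e set \<Rightarrow> 'q \<Rightarrow> 'q" where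
  "open_side R A q = (if label R q \<in> A then side R q else seg R q)"

definition cut_side :: "('v, 'e, 'q) ribbon \<Rightarrow> 'e set \<Rightarrow> 'q \<Rightarrow> 'q" where
  "cut_side R A q = (if label R q \<in> A then seg R q else side R q)"

definition on_wall :: "('v, 'e, 'q) ribbon \<Rightarrow> 'e set \<Rightarrow> 'q \<Rightarrow> real \<times> real \<times> real \<Rightarrow> bool" where
  "on_wall R A q = (\<lambda>(a, b, c). if label R q \<in> A then c = 0 else a = 0)"

text \<open>
  The third corner \<open>(0, 1, 0)\<close> of the triangle, the crossing of \<open>e\<close> and \<open>e\<^sup>*\<close>, is on the wall for
  every label.
\<close>

definition cut :: "('v, 'e, 'q) ribbon \<Rightarrow> 'e set \<Rightarrow> 'q \<Rightarrow> real \<times> real \<times> real \<Rightarrow> bool" where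
  "cut R A q x \<longleftrightarrow> x = (1, 0, 0) \<or> x = (0, 0, 1) \<or> on_wall R A q x"

lemma ribbon_graphD:
  assumes "ribbon_graph R"
  shows "finite (corners R)" "finite (discs R)" "finite (bands R)"
    "matching (corners R) (seg R)" "matching (corners R) (gap R)" "matching (corners R) (side R)"
    "\<And>q. q \<in> corners R \<Longrightarrow> label R (seg R q) = label R q"
    "\<And>q. q \<in> corners R \<Longrightarrow> label R (side R q) = label R q"
    "\<And>q. q \<in> corners R \<Longrightarrow> side R q \<noteq> seg R q"
    "\<And>q. q \<in> corners R \<Longrightarrow> label R q \<in> bands R"
    "\<And>q. q \<in> corners R \<Longrightarrow> disc_of R q \<in> discs R"
    "\<And>e. e \<in> bands R \<Longrightarrow> card (corners_on R {e}) = 4"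
proof -
  have *: "arrow_marked_ribbon_graph R" "colours R = {}"
    using assms by (auto simp: ribbon_graph_def)
  have **: "\<And>q. q \<in> corners R \<Longrightarrow> label R q \<in> bands R"
    using * unfolding arrow_marked_ribbon_graph_def by simp
  then have "corners_on R (bands R) = corners R"
    unfolding corners_on_def by auto
  with * ** show "finite (corners R)" "finite (discs R)" "finite (bands R)"
    "matching (corners R) (seg R)" "matching (corners R) (gap R)" "matching (corners R) (side R)"
    "\<And>q. q \<in> corners R \<Longrightarrow> label R (seg R q) = label R q"
    "\<And>q. q \<in> corners R \<Longrightarrow> label R (side R q) = label R q"
    "\<And>q. q \<in> corners R \<Longrightarrow> side R q \<noteq> seg R q"
    "\<And>q. q \<in> corners R \<Longrightarrow> label R q \<in> bands R"
    "\<And>q. q \<in> corners R \<Longrightarrow> disc_of R q \<in> discs R"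
    "\<And>e. e \<in> bands R \<Longrightarrow> card (corners_on R {e}) = 4"
    unfolding arrow_marked_ribbon_graph_def by simp_all
qed

text \<open>
  The boundary of an edge disc is a 4-cycle: the four corners are distinct, and there are no more.
\<close>

lemma corners_on_band:
  assumes R: "ribbon_graph R" and q: "q \<in> corners R"
  shows "corners_on R {label R q} = {q, seg R q, side R q, seg R (side R q)}"
proof -
  note r = ribbon_graphD[OF R]
  let ?X = "{q, seg R q, side R q, seg R (side R q)}"
  have s: "seg R q \<in> corners R" "side R q \<in> corners R" "seg R (side R q) \<in> corners R"
    "seg R q \<noteq> q" "side R q \<noteq> q" "seg R (seg R q) = q" "seg R (side R q) \<noteq> side R q"
    "seg R (seg R (side R q)) = side R q"
    using r(4,6) q unfolding matching_def by auto
  have "seg R (side R q) \<noteq> q" "seg R (side R q) \<noteq> seg R q"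
    using s r(9)[OF q] by metis+
  then have "card ?X = 4"
    using s r(9)[OF q] by auto
  moreover have "?X \<subseteq> corners_on R {label R q}"
    using q s r(7,8) unfolding corners_on_def by auto
  moreover have "card (corners_on R {label R q}) = 4"
    using r(10,12) q by simp
  ultimately show ?thesis
    by (metis card.infinite card_subset_eq zero_neq_numeral)
qed

text \<open>
  Apart from vertices and face centres, points of an edge or dual edge are only on triangles of
  that edge.
\<close>

lemma glued_wall_label:
  assumes "ribbon_graph R" "p \<in> corners R" "x \<in> triangle" "on_wall R A p x"
    and "x \<noteq> (1, 0, 0)" "x \<noteq> (0, 0, 1)" "glued R p q x"
  shows "label R q = label R p"
  using assms(2-) ribbon_graphD(7,8)[OF assms(1)]
  unfolding glued_def on_wall_def triangle_def by (auto split: if_splits)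

lemma triangle_simps:
  "(a, b, c) \<in> triangle \<longleftrightarrow> a \<ge> 0 \<and> b \<ge> 0 \<and> c \<ge> 0 \<and> a + b + c = 1"
  by (simp add: triangle_def)

lemma compact_triangle: "compact triangle"
proof -
  have eq: "triangle = ({0..1} \<times> {0..1} \<times> {0..1}) \<inter> {x. fst x + fst (snd x) + snd (snd x) = 1}"
    by (auto simp: triangle_def)
  have "closed {x :: real \<times> real \<times> real. fst x + fst (snd x) + snd (snd x) = 1}"
    by (intro closed_Collect_eq continuous_intros)
  then show ?thesis
    unfolding eq by (intro compact_Int_closed compact_Times compact_Icc)
qed

text \<open>
  For labels in \<open>A\<close> the uncut points are those with \<open>0 < c < 1\<close>, for other labels those with
  \<open>0 < a < 1\<close>.
\<close>

lemma convex_uncut: "convex {x \<in> triangle. \<not> cut R A q x}"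
proof -
  let ?a = "\<lambda>x :: real \<times> real \<times> real. fst x" and ?b = "\<lambda>x :: real \<times> real \<times> real. fst (snd x)"
    and ?c = "\<lambda>x :: real \<times> real \<times> real. snd (snd x)"
  have "{x \<in> triangle. \<not> cut R A q x} =
      ?a -` {0..} \<inter> ?b -` {0..} \<inter> ?c -` {0..} \<inter> (\<lambda>x. ?a x + ?b x + ?c x) -` {1} \<inter>
      (if label R q \<in> A then ?c -` {0<..<1} else ?a -` {0<..<1})"
    by (auto simp: cut_def on_wall_def triangle_def)
  moreover have "linear ?a" "linear ?b" "linear ?c" "linear (\<lambda>x. ?a x + ?b x + ?c x)"
    by (auto intro!: linearI simp: algebra_simps)
  then have "convex (?a -` {0..})" "convex (?b -` {0..})" "convex (?c -` {0..})"
    "convex (?c -` {0<..<1})" "convex (?a -` {0<..<1})" "convex ((\<lambda>x. ?a x + ?b x + ?c x) -` {1})"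
    by (auto intro!: convex_linear_vimage)
  ultimately show ?thesis
    by (auto intro!: convex_Int)
qed

text \<open>
  A surface triangulated according to the ribbon graph \<open>R\<close>, and a set \<open>N\<close>, given by its trace
  on each triangle, along which it is cut.
\<close>

locale dissected_surface =
  fixes S :: "'a::t2_space set" and R :: "('v, 'e, 'q) ribbon"
    and T :: "'q \<Rightarrow> real \<times> real \<times> real \<Rightarrow> 'a" and A :: "'e set" and N :: "'a set"
  assumes ribbon: "ribbon_graph R"
    and cont: "q \<in> corners R \<Longrightarrow> continuous_on triangle (T q)"
    and cover: "S = (\<Union>q\<in>corners R. T q ` triangle)"
    and T_eq: "\<lbrakk>p \<in> corners R; q \<in> corners R; x \<in> triangle; y \<in> triangle\<rbrakk>
       \<Longrightarrow> T p x = T q y \<longleftrightarrow> x = y \<and> glued R p q x"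
    and N_iff: "\<lbrakk>q \<in> corners R; x \<in> triangle\<rbrakk> \<Longrightarrow> T q x \<in> N \<longleftrightarrow> cut R A q x"
begin

abbreviation orb :: "'q \<Rightarrow> 'q set" where
  "orb \<equiv> circle (open_side R A) (gap R)"

definition piece :: "'q \<Rightarrow> 'a set" where
  "piece q = T q ` {x \<in> triangle. \<not> cut R A q x}"

definition region :: "'q set \<Rightarrow> 'a set" where
  "region C = (\<Union>q\<in>C. piece q)"

text \<open>
  The choice of the corner is immaterial by \<open>piece_meet\<close> below; outside \<open>S - N\<close> the value is
  arbitrary.
\<close>

definition orbit_at :: "'a \<Rightarrow> 'q set" where
  "orbit_at y = orb (SOME q. q \<in> corners R \<and> y \<in> piece q)"

lemmas rg = ribbon_graphD[OF ribbon]

lemma matching_open: "matching (corners R) (open_side R A)"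
  using rg(4,6,7,8) unfolding matching_def open_side_def by auto

lemmas orb_equiv = circle_equiv[OF matching_open rg(5)]

lemma piece_eq: "q \<in> corners R \<Longrightarrow> piece q = T q ` triangle - N"
  using N_iff unfolding piece_def by auto

lemma piece_subset: "q \<in> corners R \<Longrightarrow> piece q \<subseteq> S - N"
  using piece_eq cover by auto

lemma complement_pieces: "S - N = (\<Union>q\<in>corners R. piece q)"
  using piece_eq cover by auto

text \<open>
  Two triangles can only share an uncut point on an open side: shared corners and cut sides have
  been removed.
\<close>

lemma piece_meet:
  assumes "p \<in> corners R" "q \<in> corners R" "y \<in> piece p" "y \<in> piece q"
  shows "orb p = orb q"
proof -
  obtain a b c where x: "(a, b, c) \<in> triangle" "\<not> cut R A p (a, b, c)" "y = T p (a, b, c)"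
    using assms(3) unfolding piece_def by auto
  obtain x' where "x' \<in> triangle" "y = T q x'"
    using assms(4) unfolding piece_def by auto
  then have "glued R p q (a, b, c)"
    using T_eq[OF assms(1,2) x(1)] x(3) by metis
  then have "q = p \<or> q = open_side R A p \<or> q = gap R p"
    using x(1,2) unfolding glued_def cut_def on_wall_def open_side_def triangle_def by (auto split: if_splits)
  then have "q \<in> orb p"
    using circle_refl circle_step by metis
  then show ?thesis
    using orb_equiv(2)[OF assms(1)] by simp
qed

lemma orbit_at_eq: "q \<in> corners R \<Longrightarrow> y \<in> piece q \<Longrightarrow> orbit_at y = orb q"
  unfolding orbit_at_def by (rule someI2[of _ q]) (simp, metis piece_meet)

text \<open>
  The midpoint of the common open side survives the cut.
\<close>

lemma pieces_touch:
  assumes "p \<in> corners R" "q = open_side R A p \<or> q = gap R p"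
  shows "piece p \<inter> piece q \<noteq> {}"
proof -
  have q: "q \<in> corners R"
    using assms matching_open rg(5) unfolding matching_def by auto
  define x :: "real \<times> real \<times> real" where
    "x = (if q = gap R p then (1/2, 0, 1/2) else if label R p \<in> A then (0, 1/2, 1/2) else (1/2, 1/2, 0))"
  have x: "x \<in> triangle"
    by (simp add: x_def triangle_def)
  have "glued R p q x" "\<not> cut R A p x"
    using assms by (auto simp: x_def glued_def cut_def on_wall_def open_side_def)
  then have "T p x = T q x" "T p x \<in> piece p"
    using T_eq[OF assms(1) q x x] x unfolding piece_def by (simp, intro imageI) simp
  moreover have "T p x \<in> piece q"
    using calculation piece_eq[OF assms(1)] piece_eq[OF q] x by auto
  ultimately show ?thesis by auto
qed

lemma connected_piece: "q \<in> corners R \<Longrightarrow> connected (piece q)"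
  unfolding piece_def
  by (intro connected_continuous_image convex_connected convex_uncut continuous_on_subset[OF cont]) auto

lemma piece_nonempty: "q \<in> corners R \<Longrightarrow> piece q \<noteq> {}"
  using pieces_touch by blast

text \<open>
  An orbit is a chain of pieces in which consecutive ones touch.
\<close>

lemma connected_region:
  assumes q: "q \<in> corners R"
  shows "connected (region (orb q))"
proof -
  have mem: "y \<in> connected_component_set (region (orb q)) z"
    if "p \<in> orb q" "y \<in> piece p" "z \<in> piece q" for p y z
  proof -
    have "(q, p) \<in> {(x, y). y = open_side R A x \<or> y = gap R x}\<^sup>*"
      using that(1) by (simp add: circle_def)
    then show ?thesis using that(2)
    proof (induction arbitrary: y rule: rtrancl_induct)
      case base
      have "piece q \<subseteq> region (orb q)"
        using circle_refl unfolding region_def by fast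
      from connected_component_maximal[OF that(3) connected_piece[OF q] this]
      show ?case
        using base by (rule subsetD)
    next
      case (step p p')
      have orb: "p \<in> orb q" "p' \<in> orb q"
        using step(1,2) unfolding circle_def by (auto intro: rtrancl_into_rtrancl)
      then have cor: "p \<in> corners R" "p' \<in> corners R"
        using orb_equiv(1)[OF q] by auto
      obtain w where w: "w \<in> piece p" "w \<in> piece p'"
        using pieces_touch[OF cor(1), of p'] step(2) by auto
      have "connected_component (region (orb q)) z w"
        using step.IH[OF w(1)] by simp
      moreover have "connected_component (region (orb q)) w y"
        using connected_piece[OF cor(2)] w(2) step.prems orb(2)
        by (intro connected_componentI[of "piece p'"]) (auto simp: region_def)
      ultimately show ?case
        by (auto intro: connected_component_trans)
    qed
  qed
  obtain z where z: "z \<in> piece q"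
    using piece_nonempty[OF q] by auto
  show ?thesis
    unfolding connected_iff_connected_component
  proof (intro ballI)
    fix x y assume "x \<in> region (orb q)" "y \<in> region (orb q)"
    then have "connected_component (region (orb q)) z x" "connected_component (region (orb q)) z y"
      using mem[OF _ _ z] unfolding region_def by blast+
    then show "connected_component (region (orb q)) x y"
      by (meson connected_component_sym connected_component_trans)
  qed
qed

lemma region_iff:
  assumes "q \<in> corners R"
  shows "y \<in> region (orb q) \<longleftrightarrow> y \<in> S - N \<and> orbit_at y = orb q"
proof
  assume "y \<in> region (orb q)"
  then obtain p where p: "p \<in> orb q" "y \<in> piece p"
    unfolding region_def by auto
  then show "y \<in> S - N \<and> orbit_at y = orb q"
    using orb_equiv[OF assms p(1)] orbit_at_eq[of p y] piece_subset[of p] by auto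
next
  assume *: "y \<in> S - N \<and> orbit_at y = orb q"
  then obtain p where p: "p \<in> corners R" "y \<in> piece p"
    unfolding complement_pieces by auto
  then have "p \<in> orb q"
    using * orbit_at_eq circle_refl by fastforce
  with p show "y \<in> region (orb q)"
    unfolding region_def by auto
qed

lemma compact_cell: "q \<in> corners R \<Longrightarrow> compact (T q ` triangle)"
  by (rule compact_continuous_image[OF cont compact_triangle])

text \<open>
  The region of an orbit is the trace on \<open>S - N\<close> of a finite union of compact triangles, hence
  closed; so the finitely many regions are the components.
\<close>

lemma components_complement: "components (S - N) = (\<lambda>q. region (orb q)) ` corners R"
proof (rule components_eq_finite_partition)
  show "finite ((\<lambda>q. region (orb q)) ` corners R)"
    using rg(1) by simp
  show "\<Union>((\<lambda>q. region (orb q)) ` corners R) = S - N"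
  proof
    show "S - N \<subseteq> \<Union>((\<lambda>q. region (orb q)) ` corners R)"
      unfolding complement_pieces region_def using circle_refl by fast
    show "\<Union>((\<lambda>q. region (orb q)) ` corners R) \<subseteq> S - N"
      using region_iff by auto
  qed
  show "pairwise disjnt ((\<lambda>q. region (orb q)) ` corners R)"
    unfolding pairwise_def disjnt_def using region_iff by (auto simp: set_eq_iff)
  fix C assume "C \<in> (\<lambda>q. region (orb q)) ` corners R"
  then obtain q where q: "q \<in> corners R" "C = region (orb q)"
    by auto
  have sub: "orb q \<subseteq> corners R"
    using orb_equiv(1)[OF q(1)] by auto
  have "C = (\<Union>p\<in>orb q. T p ` triangle - N)"
    unfolding q region_def using sub piece_eq by (intro SUP_cong) auto
  also have "\<dots> = (S - N) \<inter> (\<Union>p\<in>orb q. T p ` triangle)"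
    using sub unfolding cover by blast
  finally have "C = (S - N) \<inter> (\<Union>p\<in>orb q. T p ` triangle)" .
  moreover have "closed (\<Union>p\<in>orb q. T p ` triangle)"
    using sub rg(1) compact_cell by (auto intro!: closed_UN compact_imp_closed intro: finite_subset)
  moreover have "C \<noteq> {}"
    using piece_nonempty[OF q(1)] circle_refl unfolding q region_def by fast
  ultimately show "C \<noteq> {} \<and> connected C \<and> closedin (top_of_set (S - N)) C"
    using connected_region[OF q(1)] q by (auto intro: closedin_closed_Int)
qed

lemma orbit_at_corner: "y \<in> S - N \<Longrightarrow> \<exists>q\<in>corners R. y \<in> piece q \<and> orbit_at y = orb q"
  unfolding complement_pieces using orbit_at_eq by auto

lemma orbit_at_const:
  assumes "connected Z" "Z \<subseteq> S - N" "y \<in> Z" "z \<in> Z"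
  shows "orbit_at y = orbit_at z"
proof -
  obtain q where q: "q \<in> corners R" "orbit_at y = orb q"
    using orbit_at_corner assms by blast
  have C: "region (orb q) \<in> components (S - N)"
    unfolding components_complement using q(1) by (rule imageI)
  have "y \<in> S - N"
    using assms(2,3) by (rule subsetD)
  then have "y \<in> region (orb q)"
    using region_iff[OF q(1)] q(2) by metis
  then have "region (orb q) \<inter> Z \<noteq> {}"
    using assms(3) by (metis IntI empty_iff)
  from components_maximal[OF C assms(1,2) this]
  have "Z \<subseteq> region (orb q)" .
  then have "z \<in> region (orb q)"
    using assms(4) by blast
  then show ?thesis
    unfolding region_iff[OF q(1)] using q(2) by simp
qed

text \<open>
  The vertices of any dual of the cut graph correspond to the orbits.
\<close>

lemma representatives_bij:
  assumes sub: "V \<subseteq> \<Union>(components (S - N))"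
    and ex1: "\<And>F. F \<in> components (S - N) \<Longrightarrow> \<exists>!v. v \<in> V \<inter> F"
  shows "bij_betw orbit_at V (orb ` corners R)"
  unfolding bij_betw_def
proof
  have V: "V \<subseteq> S - N"
    using sub by (simp add: Union_components)
  show "inj_on orbit_at V"
  proof (rule inj_onI)
    fix v w assume vw: "v \<in> V" "w \<in> V" "orbit_at v = orbit_at w"
    then obtain q where q: "q \<in> corners R" "orbit_at v = orb q"
      using orbit_at_corner V by blast
    then have "v \<in> V \<inter> region (orb q)" "w \<in> V \<inter> region (orb q)"
      using vw V region_iff by auto
    then show "v = w"
      using ex1[of "region (orb q)"] components_complement q(1) by blast
  qed
  show "orbit_at ` V = orb ` corners R"
  proof
    show "orbit_at ` V \<subseteq> orb ` corners R"
      using orbit_at_corner V by blast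
    show "orb ` corners R \<subseteq> orbit_at ` V"
    proof
      fix C assume "C \<in> orb ` corners R"
      then obtain q where q: "q \<in> corners R" "C = orb q" by auto
      then obtain v where "v \<in> V" "v \<in> region (orb q)"
        using ex1[of "region (orb q)"] components_complement by blast
      then show "C \<in> orbit_at ` V"
        using region_iff[OF q(1)] q by auto
    qed
  qed
qed

lemma cut_side_glued:
  assumes "q \<in> corners R" "x \<in> triangle" "on_wall R A q x"
  shows "cut_side R A q \<in> corners R" "T (cut_side R A q) x = T q x"
proof -
  show *: "cut_side R A q \<in> corners R"
    using rg(4,6) assms(1) unfolding cut_side_def matching_def by auto
  have "glued R q (cut_side R A q) x"
    using assms(3) unfolding glued_def cut_side_def on_wall_def by (auto split: if_splits)
  then show "T (cut_side R A q) x = T q x"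
    using T_eq[OF assms(1) * assms(2) assms(2)] by simp
qed

lemma orb_open_side: "q \<in> corners R \<Longrightarrow> orb (open_side R A q) = orb q"
  using orb_equiv(2) circle_step(1) by metis

text \<open>
  The four corners of a band meet at most two orbits, one on each side of its cut line.
\<close>

lemma orb_band:
  assumes q: "q \<in> corners R"
  shows "orb ` corners_on R {label R q} = {orb q, orb (cut_side R A q)}"
proof -
  have cor: "seg R q \<in> corners R" "side R q \<in> corners R"
    using rg(4,6) q unfolding matching_def by auto
  have "side R (seg R q) \<in> {q, seg R q, side R q, seg R (side R q)}"
    using cor rg(6-8) q unfolding corners_on_band[OF ribbon q, symmetric] corners_on_def matching_def
    by auto
  moreover have "side R (seg R q) \<noteq> seg R q" "side R (seg R q) \<noteq> side R q" "side R (seg R q) \<noteq> q"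
    using cor rg(4,6,9) q unfolding matching_def by metis+
  ultimately have comm: "side R (seg R q) = seg R (side R q)"
    by auto
  show ?thesis
    using orb_open_side[OF q] orb_open_side[OF cor(1)] orb_open_side[OF cor(2)] rg(7,8) q
    unfolding corners_on_band[OF ribbon q] by (auto simp: open_side_def cut_side_def comm)
qed

text \<open>
  A neighbourhood of the interior of the cut line of \<open>e\<close> that avoids all vertices, face centres and
  triangles of other edges.  Inside it the cut consists of the wall of \<open>e\<close> alone.
\<close>

definition vicinity :: "'e \<Rightarrow> 'a set" where
  "vicinity e = S - ((\<Union>p\<in>{p \<in> corners R. label R p \<noteq> e}. T p ` triangle) \<union>
     (\<Union>p\<in>corners R. {T p (1, 0, 0), T p (0, 0, 1)}))"

definition wall :: "'e \<Rightarrow> 'a set" where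
  "wall e = (\<Union>p\<in>corners_on R {e}. T p ` {y \<in> triangle. on_wall R A p y})"

lemma openin_vicinity: "openin (top_of_set S) (vicinity e)"
proof -
  have "closed ((\<Union>p\<in>{p \<in> corners R. label R p \<noteq> e}. T p ` triangle) \<union>
     (\<Union>p\<in>corners R. {T p (1, 0, 0), T p (0, 0, 1)}))" (is "closed ?K")
    using rg(1) compact_cell by (intro closed_Un closed_UN) (auto intro: compact_imp_closed)
  then have "openin (top_of_set S) (S \<inter> - ?K)"
    by (intro openin_open_Int open_Compl)
  then show ?thesis
    by (simp add: vicinity_def Diff_eq)
qed

lemma mem_vicinity:
  assumes "q \<in> corners R" "x \<in> triangle" "on_wall R A q x" "x \<noteq> (1, 0, 0)" "x \<noteq> (0, 0, 1)"
  shows "T q x \<in> vicinity (label R q)"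
proof -
  have "label R p = label R q" if "p \<in> corners R" "y \<in> triangle" "T q x = T p y" for p y
    using glued_wall_label[OF ribbon assms] T_eq[OF assms(1) that(1) assms(2) that(2)] that(3) by metis
  moreover have "T q x \<noteq> T p y" if "p \<in> corners R" "y = (1, 0, 0) \<or> y = (0, 0, 1)" for p y
    using T_eq[OF assms(1) that(1) assms(2), of y] that(2) assms(4,5) by (auto simp: triangle_simps)
  moreover have "T q x \<in> S"
    using assms cover by auto
  ultimately show ?thesis
    unfolding vicinity_def by blast
qed

lemma vicinity_cut: "vicinity e \<inter> N \<subseteq> wall e"
proof
  fix y assume y: "y \<in> vicinity e \<inter> N"
  then have "y \<in> S"
    unfolding vicinity_def by blast
  then obtain p z where p: "p \<in> corners R" "z \<in> triangle" "y = T p z"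
    using cover by blast
  then have "label R p = e" "z \<noteq> (1, 0, 0)" "z \<noteq> (0, 0, 1)" "cut R A p z"
    using y N_iff[OF p(1,2)] unfolding vicinity_def by blast+
  then show "y \<in> wall e"
    using p unfolding wall_def corners_on_def cut_def by blast
qed

lemma wall_subset: "wall e \<subseteq> N"
  using N_iff unfolding wall_def cut_def corners_on_def by auto

lemma vicinity_orbit:
  assumes "y \<in> vicinity e" "y \<notin> N"
  shows "orbit_at y \<in> orb ` corners_on R {e}"
proof -
  obtain p where p: "p \<in> corners R" "y \<in> piece p" "orbit_at y = orb p"
    using orbit_at_corner[of y] assms unfolding vicinity_def by auto
  then have "label R p = e"
    using assms unfolding vicinity_def piece_def by blast
  with p show ?thesis
    unfolding corners_on_def by auto
qed

text \<open>
  Points on the boundary of a triangle are limits of points of its interior, which no cut meets.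
\<close>

lemma orbit_at_near:
  assumes q: "q \<in> corners R" and x: "x \<in> triangle" and V: "openin (top_of_set S) V" "T q x \<in> V"
  shows "\<exists>y\<in>V. y \<notin> N \<and> orbit_at y = orb q"
proof -
  obtain a b c where abc: "x = (a, b, c)" by (cases x)
  \<comment> \<open>the segment from \<open>x\<close> to the barycentre enters the interior at once\<close>
  define \<gamma> :: "real \<Rightarrow> real \<times> real \<times> real" where
    "\<gamma> s = ((1 - s) * a + s / 3, (1 - s) * b + s / 3, (1 - s) * c + s / 3)" for s
  have tri: "\<gamma> s \<in> triangle" if "s \<in> {0..1}" for s
  proof -
    have "a \<ge> 0" "b \<ge> 0" "c \<ge> 0" and c: "c = 1 - a - b"
      using x unfolding abc triangle_simps by auto
    then have "(1 - s) * a \<ge> 0" "(1 - s) * b \<ge> 0" "(1 - s) * c \<ge> 0"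
      using that by auto
    moreover have "((1 - s) * a + s / 3) + ((1 - s) * b + s / 3) + ((1 - s) * c + s / 3) = 1"
      unfolding c by (simp add: algebra_simps)
    ultimately show ?thesis
      using that unfolding \<gamma>_def triangle_simps by simp
  qed
  have "continuous_on {0..1} \<gamma>"
    unfolding \<gamma>_def by (intro continuous_intros) auto
  then have "continuous_on {0..1} (T q \<circ> \<gamma>)"
    using tri by (intro continuous_on_compose continuous_on_subset[OF cont[OF q]]) auto
  moreover have "(T q \<circ> \<gamma>) \<in> {0..1} \<rightarrow> S"
    using tri q cover by auto
  ultimately have "openin (top_of_set {0..1}) ({0..1} \<inter> (T q \<circ> \<gamma>) -` V)"
    using V(1) continuous_openin_preimage by blast
  moreover have "0 \<in> {0..1} \<inter> (T q \<circ> \<gamma>) -` V"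
    using V(2) by (simp add: \<gamma>_def abc)
  ultimately obtain d where "d > 0"
    "\<forall>s\<in>{0..1}. dist s 0 < d \<longrightarrow> s \<in> {0..1} \<inter> (T q \<circ> \<gamma>) -` V"
    unfolding openin_euclidean_subtopology_iff by blast
  then have d: "d > 0" "\<And>s. \<lbrakk>s \<in> {0..1}; dist s 0 < d\<rbrakk> \<Longrightarrow> T q (\<gamma> s) \<in> V"
    by auto
  define s where "s = min (d / 2) (1/2)"
  have s: "s > 0" "s < 1" "s < d"
    using d(1) by (auto simp: s_def)
  have "\<not> cut R A q (\<gamma> s)"
  proof -
    have "(1 - s) * a + s / 3 > 0" "(1 - s) * b + s / 3 > 0" "(1 - s) * c + s / 3 > 0"
      using s x unfolding abc triangle_simps by (auto intro!: add_nonneg_pos)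
    then show ?thesis
      unfolding cut_def on_wall_def \<gamma>_def by (auto split: if_splits)
  qed
  then have "T q (\<gamma> s) \<in> piece q"
    using tri[of s] s unfolding piece_def by (intro imageI) simp
  then have "T q (\<gamma> s) \<notin> N" "orbit_at (T q (\<gamma> s)) = orb q"
    using piece_subset[OF q] orbit_at_eq[OF q] by auto
  moreover have "T q (\<gamma> s) \<in> V"
    using d(2)[of s] s by auto
  ultimately show ?thesis by blast
qed

text \<open>
  Suppose that a curve \<open>Y\<close> crosses the wall of an edge at a point and otherwise stays in the region
  of one orbit \<open>C\<close>.  In the chart given by the crossing, each of the two open half discs beside the
  wall is connected, misses the cut, and contains points of \<open>Y\<close>; so both lie in that region.
  Every triangle at the crossing reaches into one of the half discs and thus belongs to \<open>C\<close>.
\<close>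

lemma one_orbit_at_crossing:
  assumes q: "q \<in> corners R" and x: "x \<in> triangle" "on_wall R A q x" "x \<noteq> (1, 0, 0)" "x \<noteq> (0, 0, 1)"
    and cross: "cross_at S (wall (label R q)) Y (T q x)"
    and Y: "\<And>y. y \<in> Y \<Longrightarrow> y \<noteq> T q x \<Longrightarrow> orbit_at y = C"
    and p: "p \<in> corners R" "T p x = T q x"
  shows "orb p = C"
proof -
  let ?e = "label R q"
  obtain U h j where U: "openin (top_of_set S) U" "T q x \<in> U"
    and hom: "homeomorphism U (ball 0 1 :: complex set) h j" and h0: "h (T q x) = 0"
    and hX: "h ` (U \<inter> wall ?e) = {z \<in> ball 0 1. Im z = 0}"
    and hY: "h ` (U \<inter> Y) = {z \<in> ball 0 1. Re z = 0}"
    using cross unfolding cross_at_def by blast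
  have jh: "\<And>u. u \<in> U \<Longrightarrow> j (h u) = u" and hU: "h ` U = ball 0 1"
    and conth: "continuous_on U h" and contj: "continuous_on (ball 0 1) j"
    using hom unfolding homeomorphism_def by auto
  have "openin (top_of_set U) (U \<inter> vicinity ?e)"
  proof -
    obtain W where "open W" "vicinity ?e = S \<inter> W"
      using openin_vicinity[of ?e] by (auto simp: openin_open)
    moreover from this have "U \<inter> vicinity ?e = U \<inter> W"
      using openin_imp_subset[OF U(1)] by auto
    ultimately show ?thesis
      by (simp add: openin_open_Int)
  qed
  then have "openin (top_of_set (ball 0 1)) (h ` (U \<inter> vicinity ?e))"
    by (rule homeomorphism_imp_open_map[OF hom])
  then have "open (h ` (U \<inter> vicinity ?e))"
    by (rule openin_open_trans) simp
  moreover have "0 \<in> h ` (U \<inter> vicinity ?e)"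
    using mem_vicinity[OF q x] U(2) h0 by force
  ultimately obtain r where r: "r > 0" "ball 0 r \<subseteq> h ` (U \<inter> vicinity ?e)"
    using open_contains_ball by blast
  have r1: "ball 0 r \<subseteq> ball (0::complex) 1"
    using r(2) hU by auto
  \<comment> \<open>\<open>B\<close> is the half disc, above or below the real axis, that contains \<open>z\<close>; the curve \<open>Y\<close> is
    the imaginary axis and meets it in \<open>?w\<close>\<close>
  have half: "orbit_at (j z) = C" if z: "z \<in> ball 0 r" "Im z \<noteq> 0" for z
  proof -
    define B where "B = {w \<in> ball 0 r. Im w * sgn (Im z) > 0}"
    have "B = ball 0 r \<inter> {w. (sgn (Im z) *\<^sub>R \<i>) \<bullet> w > 0}"
      by (auto simp: B_def inner_complex_def mult.commute)
    then have "convex B"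
      by (simp only: convex_Int convex_halfspace_gt convex_ball)
    then have "connected (j ` B)"
      using r1 by (intro connected_continuous_image convex_connected continuous_on_subset[OF contj]) (auto simp: B_def)
    moreover have sub: "j ` B \<subseteq> S - N"
    proof
      fix y assume "y \<in> j ` B"
      then obtain w where w: "w \<in> B" "y = j w" by auto
      then obtain u where u: "u \<in> U \<inter> vicinity ?e" "w = h u"
        using r(2) unfolding B_def by blast
      then have "y = u"
        using jh w by simp
      moreover have "u \<notin> wall ?e"
      proof
        assume "u \<in> wall ?e"
        then have "h u \<in> {z \<in> ball 0 1. Im z = 0}"
          using u hX by blast
        then show False
          using w u by (simp add: B_def)
      qed
      ultimately show "y \<in> S - N"
        using u vicinity_cut[of ?e] openin_imp_subset[OF openin_vicinity[of ?e]] by blast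
    qed
    moreover have "z \<in> B"
      using z by (simp add: B_def sgn_if)
    moreover obtain u where "u \<in> Y" "u \<noteq> T q x" "u \<in> j ` B"
    proof -
      let ?w = "Complex 0 (sgn (Im z) * r / 2)"
      have "norm ?w = r / 2"
        using r(1) z(2) by (simp add: complex_norm abs_mult abs_sgn_eq)
      then have w: "?w \<in> ball 0 r"
        using r(1) by simp
      then have "?w \<in> h ` (U \<inter> Y)"
        unfolding hY using r1 by auto
      then obtain u where u: "u \<in> U" "u \<in> Y" "h u = ?w"
        by auto
      have "?w \<noteq> 0"
        using z(2) r(1) by (simp add: complex_eq_iff sgn_if)
      then have "u \<noteq> T q x"
        using h0 u(3) by auto
      moreover have "?w \<in> B"
        using w r(1) z(2) by (simp add: B_def sgn_if)
      then have "u \<in> j ` B"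
        using u jh by (metis imageI)
      ultimately show ?thesis
        using that u(2) by blast
    qed
    ultimately show ?thesis
      using Y orbit_at_const[of "j ` B" "j z" u] by auto
  qed
  define V where "V = U \<inter> h -` ball 0 r"
  have "openin (top_of_set U) V"
    unfolding V_def using conth by (rule continuous_openin_preimage_gen) simp
  then have "openin (top_of_set S) V"
    using U(1) by (rule openin_trans)
  moreover have "T p x \<in> V"
    using U(2) h0 r(1) p(2) by (simp add: V_def)
  ultimately obtain y where y: "y \<in> V" "y \<notin> N" "orbit_at y = orb p"
    using orbit_at_near[OF p(1) x(1)] by blast
  have "Im (h y) \<noteq> 0"
  proof
    assume "Im (h y) = 0"
    then have "h y \<in> h ` (U \<inter> wall ?e)"
      using y(1) r1 unfolding hX V_def by auto
    then obtain u where "u \<in> U" "u \<in> wall ?e" "h y = h u" by auto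
    then have "y \<in> wall ?e"
      using jh y(1) unfolding V_def by (metis IntD1)
    then show False
      using wall_subset y(2) by blast
  qed
  then have "orbit_at (j (h y)) = C"
    using half y(1) unfolding V_def by auto
  then show ?thesis
    using jh y unfolding V_def by simp
qed

text \<open>
  The curve \<open>k\<close> meets the cut only at the crossing, so each of its two halves stays in one region.
  Close to the crossing the halves run through triangles of the crossed edge, which are in at most
  two orbits; if the halves are in the same orbit, then these two coincide by
  \<open>one_orbit_at_crossing\<close>.
\<close>

lemma crossing_ends:
  assumes q: "q \<in> corners R" and x: "x \<in> triangle" "on_wall R A q x" "x \<noteq> (1, 0, 0)" "x \<noteq> (0, 0, 1)"
    and k: "simple_path k" "path_image k \<subseteq> S" "path_image k \<inter> N = {T q x}"
    and ends: "pathstart k \<notin> N" "pathfinish k \<notin> N"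
    and cross: "cross_at S (wall (label R q)) (path_image k) (T q x)"
  shows "{orbit_at (pathstart k), orbit_at (pathfinish k)} = orb ` corners_on R {label R q}"
proof -
  have contk: "continuous_on {0..1} k"
    using k(1) by (simp add: simple_path_def path_def)
  obtain t where t: "t \<in> {0..1}" "k t = T q x"
    using k(3) unfolding path_image_def by (metis IntD1 imageE insertI1)
  have xN: "T q x \<in> N"
    using k(3) by blast
  then have t01: "0 < t" "t < 1"
    using t ends unfolding pathstart_def pathfinish_def by (metis atLeastAtMost_iff order_le_less)+
  have off: "k s \<in> S - N" if "s \<in> {0..1}" "s \<noteq> t" for s
  proof -
    have "k s \<noteq> T q x"
      using k(1) that t t01 unfolding simple_path_def loop_free_def by (metis less_irrefl)
    moreover have "k s \<in> path_image k"
      using that by (auto simp: path_image_def)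
    ultimately show ?thesis
      using k(2,3) by blast
  qed
  have conn: "connected (k ` {0..<t})" "connected (k ` {t<..1})"
    using t01 by (auto intro!: connected_continuous_image continuous_on_subset[OF contk])
  have side1: "orbit_at (k s) = orbit_at (pathstart k)" if "s \<in> {0..<t}" for s
    using that t01 off unfolding pathstart_def
    by (intro orbit_at_const[OF conn(1)]) auto
  have side2: "orbit_at (k s) = orbit_at (pathfinish k)" if "s \<in> {t<..1}" for s
    using that t01 off unfolding pathfinish_def
    by (intro orbit_at_const[OF conn(2)]) auto
  let ?V = "vicinity (label R q)"
  \<comment> \<open>both halves of \<open>k\<close> contain points near the crossing\<close>
  have "openin (top_of_set {0..1}) ({0..1} \<inter> k -` ?V)"
    using contk k(2) openin_vicinity
    by (intro continuous_openin_preimage[of _ _ S]) (auto simp: path_image_def)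
  moreover have "t \<in> {0..1} \<inter> k -` ?V"
    using t mem_vicinity[OF q x] by simp
  ultimately obtain d where d: "d > 0" "\<And>s. \<lbrakk>s \<in> {0..1}; dist s t < d\<rbrakk> \<Longrightarrow> k s \<in> ?V"
    unfolding openin_euclidean_subtopology_iff by blast
  have "k (max 0 (t - d / 2)) \<in> ?V" "k (min 1 (t + d / 2)) \<in> ?V"
    using d(1) t01 by (auto intro!: d(2) simp: dist_real_def)
  then have "orbit_at (k (max 0 (t - d / 2))) \<in> orb ` corners_on R {label R q}"
    "orbit_at (k (min 1 (t + d / 2))) \<in> orb ` corners_on R {label R q}"
    using off d(1) t01 by (auto intro!: vicinity_orbit)
  then have sub: "orbit_at (pathstart k) \<in> {orb q, orb (cut_side R A q)}"
    "orbit_at (pathfinish k) \<in> {orb q, orb (cut_side R A q)}"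
    using side1[of "max 0 (t - d / 2)"] side2[of "min 1 (t + d / 2)"] d(1) t01 orb_band[OF q] by auto
  moreover have "orb q = C \<and> orb (cut_side R A q) = C"
    if "orbit_at (pathstart k) = C" "orbit_at (pathfinish k) = C" for C
  proof -
    have Y: "orbit_at y = C" if y: "y \<in> path_image k" "y \<noteq> T q x" for y
    proof -
      obtain s where s: "s \<in> {0..1}" "y = k s"
        using y(1) unfolding path_image_def by blast
      moreover from s have "s \<noteq> t"
        using y(2) t(2) by auto
      ultimately show ?thesis
        using side1[of s] side2[of s] \<open>orbit_at (pathstart k) = C\<close> \<open>orbit_at (pathfinish k) = C\<close>
        by (cases "s < t") auto
    qed
    note same = one_orbit_at_crossing[OF q x cross Y]
    show ?thesis
      using same[OF _ _ q refl] same[OF _ _ cut_side_glued[OF q x(1,2)]] by blast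
  qed
  ultimately show ?thesis
    unfolding orb_band[OF q] by (smt (verit, best) insert_absorb2 insert_commute insertE empty_iff)
qed

end

section \<open>The vertices and edges of the subdivision\<close>

lemma arc_minus_inner_point_disconnected:
  fixes g :: "real \<Rightarrow> 'a::t2_space"
  assumes g: "arc g" and t: "0 < t" "t < 1"
  shows "\<not> connected (path_image g - {g t})"
proof -
  have cont: "continuous_on {0..1} g" and inj: "inj_on g {0..1}"
    using g by (auto simp: arc_def path_def)
  have "closed (g ` {0..t})" "closed (g ` {t..1})"
    using t by (auto intro!: compact_imp_closed compact_continuous_image continuous_on_subset[OF cont])
  moreover have "path_image g - {g t} \<subseteq> g ` {0..t} \<union> g ` {t..1}"
  proof
    fix y assume "y \<in> path_image g - {g t}"
    then obtain s where "s \<in> {0..1}" "y = g s"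
      unfolding path_image_def by blast
    then show "y \<in> g ` {0..t} \<union> g ` {t..1}"
      by (cases "s \<le> t") auto
  qed
  moreover have "g ` {0..t} \<inter> g ` {t..1} \<inter> (path_image g - {g t}) = {}"
  proof -
    have "s = t" if "s \<in> {0..t}" "s' \<in> {t..1}" "g s = g s'" for s s'
      using inj_onD[OF inj that(3)] that t by auto
    then show ?thesis by blast
  qed
  moreover have "g 0 \<in> g ` {0..t} \<inter> (path_image g - {g t})" "g 1 \<in> g ` {t..1} \<inter> (path_image g - {g t})"
    using t inj_onD[OF inj, of 0 t] inj_onD[OF inj, of 1 t] unfolding path_image_def by auto
  ultimately show ?thesis
    unfolding connected_closed by blast
qed

text \<open>
  The data of a ribbon graph of an embedded graph with at least one edge, with the triangulation
  \<open>T\<close> made explicit.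
\<close>

locale barycentric_subdivision =
  fixes S :: "'a::t2_space set" and G G' :: "('a, 'e) drawing"
    and R :: "('a, 'e, 'q) ribbon" and T :: "'q \<Rightarrow> real \<times> real \<times> real \<Rightarrow> 'a"
  assumes G: "embedded S G" and connected: "connected_graph (abstract_graph G)"
    and dual: "region_dual S G G'"
    and ribbon: "ribbon_graph R" and discs: "discs R = points G" and bands: "bands R = lines G"
    and nonempty: "corners R \<noteq> {}"
    and cont: "q \<in> corners R \<Longrightarrow> continuous_on triangle (T q)"
    and cover: "S = (\<Union>q\<in>corners R. T q ` triangle)"
    and T_eq: "\<lbrakk>p \<in> corners R; q \<in> corners R; x \<in> triangle; y \<in> triangle\<rbrakk>
       \<Longrightarrow> T p x = T q y \<longleftrightarrow> x = y \<and> glued R p q x"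
    and T_disc: "q \<in> corners R \<Longrightarrow> T q (1, 0, 0) = disc_of R q"
    and T_face: "q \<in> corners R \<Longrightarrow> T q (0, 0, 1) \<in> points G'"
    and edge_image: "e \<in> lines G \<Longrightarrow>
       path_image (curve G e) = (\<Union>q\<in>corners_on R {e}. T q ` {(a, b, c) \<in> triangle. c = 0})"
    and dual_edge_image: "e \<in> lines G \<Longrightarrow>
       path_image (curve G' e) = (\<Union>q\<in>corners_on R {e}. T q ` {(a, b, c) \<in> triangle. a = 0})"
begin

lemmas rg = ribbon_graphD[OF ribbon]

lemma G': "embedded S G'" and lines_G': "lines G' = lines G"
  using dual by (auto simp: region_dual_def)

lemma vertex_has_edge:
  assumes "v \<in> points G"
  shows "\<exists>e\<in>lines G. v \<in> {pathstart (curve G e), pathfinish (curve G e)}"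
proof -
  obtain e where e: "e \<in> lines G"
    using nonempty rg(10) bands by blast
  let ?u = "pathstart (curve G e)"
  have "?u \<in> points G"
    using G e unfolding embedded_def by blast
  then have "(v, ?u) \<in> {(x, y). \<exists>e\<in>lines G. {pathstart (curve G e), pathfinish (curve G e)} = {x, y}}\<^sup>*"
    using connected assms unfolding connected_graph_def abstract_graph_def by simp
  then show ?thesis
    by (cases rule: converse_rtranclE) (use e in blast)+
qed

text \<open>
  Disc centres are vertices of \<open>G\<close>, and the inner points of an edge are not.
\<close>

lemma incident_disc_is_end:
  assumes e: "e \<in> lines G" and q: "q \<in> corners_on R {e}"
  shows "disc_of R q \<in> {pathstart (curve G e), pathfinish (curve G e)}"
proof -
  let ?g = "curve G e"
  have cor: "q \<in> corners R"
    using q by (simp add: corners_on_def)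
  have "T q (1, 0, 0) \<in> path_image ?g"
    unfolding edge_image[OF e] using q by (intro UN_I[of q] imageI) (auto simp: triangle_simps)
  then obtain t where t: "t \<in> {0..1}" "disc_of R q = ?g t"
    unfolding T_disc[OF cor] path_image_def by blast
  have "disc_of R q \<in> points G"
    using rg(11)[OF cor] discs by simp
  then have "?g t \<notin> inner ?g"
    using G e t unfolding embedded_def by auto
  then have "t = 0 \<or> t = 1"
    using t(1) unfolding inner_def by force
  then show ?thesis
    using t(2) by (auto simp: pathstart_def pathfinish_def)
qed

text \<open>
  If all corners of \<open>e\<close> are on the same disc then \<open>e\<close> is a circle: its two halves join the disc
  centre \<open>w\<close> to the midpoint of \<open>e\<close>.  The middle of either half can be removed without
  disconnecting the circle, and since there are two halves this point can be chosen to differ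
  from any prescribed point \<open>v\<close>.
\<close>

lemma loop_minus_point_connected:
  assumes e: "e \<in> lines G" and q: "q \<in> corners_on R {e}"
    and w: "\<And>p. p \<in> corners_on R {e} \<Longrightarrow> disc_of R p = w"
  obtains m where "m \<in> path_image (curve G e)" "m \<noteq> v" "m \<noteq> w"
    "connected (path_image (curve G e) - {m})"
proof -
  define s where "s p b = T p (1 - b, b, 0)" for p and b :: real
  have tri: "(1 - b, b, 0) \<in> triangle" if "b \<in> {0..1}" for b :: real
    using that by (simp add: triangle_simps)
  have q': "q \<in> corners R" "label R q = e"
    using q by (auto simp: corners_on_def)
  have opp: "side R q \<in> corners_on R {e}" "side R (side R q) = q" "side R q \<noteq> q" "side R q \<noteq> seg R q"
    using rg(6,8,9) q' unfolding corners_on_def matching_def by auto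
  have "seg R (seg R (side R q)) = side R q"
    using rg(4) opp(1) unfolding corners_on_def matching_def by blast
  then have opp': "q \<noteq> seg R (side R q)"
    using opp(4) by metis
  have img: "path_image (curve G e) = s q ` {0..1} \<union> s (side R q) ` {0..1}"
  proof -
    have I: "{(a, b, c). (a, b, c) \<in> triangle \<and> c = 0} = (\<lambda>b. (1 - b, b, 0)) ` {0..1}"
      by (auto simp: triangle_simps image_iff)
    have seg: "s (seg R p) b = s p b" if "p \<in> corners R" "b \<in> {0..1}" for p b
    proof -
      have "seg R p \<in> corners R"
        using rg(4) that(1) unfolding matching_def by auto
      then show ?thesis
        using T_eq[OF that(1) _ tri[OF that(2)] tri[OF that(2)], of "seg R p"]
        unfolding s_def glued_def by simp
    qed
    have "path_image (curve G e) = (\<Union>p\<in>corners_on R {e}. s p ` {0..1})"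
      unfolding edge_image[OF e] I s_def by (simp add: image_image)
    also have "\<dots> = s q ` {0..1} \<union> s (seg R q) ` {0..1} \<union>
        s (side R q) ` {0..1} \<union> s (seg R (side R q)) ` {0..1}"
      unfolding q'(2)[symmetric] corners_on_band[OF ribbon q'(1)] by auto
    also have "s (seg R q) ` {0..1} = s q ` {0..1}"
      using seg q'(1) by (intro image_cong) auto
    also have "s (seg R (side R q)) ` {0..1} = s (side R q) ` {0..1}"
      using seg opp(1) by (intro image_cong) (auto simp: corners_on_def)
    also have "s q ` {0..1} \<union> s q ` {0..1} \<union> s (side R q) ` {0..1} \<union> s (side R q) ` {0..1} =
        s q ` {0..1} \<union> s (side R q) ` {0..1}"
      by blast
    finally show ?thesis .
  qed
  \<comment> \<open>remove the middle of the half \<open>p\<close>: its two remains hang on the other half \<open>p'\<close>, at \<open>w\<close>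
    and at the midpoint of the edge\<close>
  have found: "\<exists>m. m \<in> path_image (curve G e) \<and> m \<noteq> v \<and> m \<noteq> w \<and>
      connected (path_image (curve G e) - {m})"
    if pp: "{p, p'} = {q, side R q}" "p \<noteq> p'" "p' \<noteq> seg R p" "s p (1/2) \<noteq> v" for p p'
  proof -
    have p: "p \<in> corners R" "p' \<in> corners R" "label R p = e" "label R p' = e"
      "p \<in> corners_on R {e}" "p' \<in> corners_on R {e}"
      using pp(1) opp(1) q q' unfolding corners_on_def by (auto simp: doubleton_eq_iff)
    have img': "path_image (curve G e) = s p ` {0..1} \<union> s p' ` {0..1}"
      using img pp(1) by (auto simp: doubleton_eq_iff)
    have conts: "continuous_on {0..1} (s r)" if "r \<in> corners R" for r
      unfolding s_def using tri
      by (intro continuous_on_compose2[OF cont[OF that]] continuous_intros) auto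
    have inj: "s p b = s p (1/2) \<longleftrightarrow> b = 1/2" if "b \<in> {0..1}" for b
      using T_eq[OF p(1,1) tri[OF that] tri[of "1/2"]] unfolding s_def by (auto simp: glued_def)
    have other: "s p (1/2) \<noteq> s p' b" if "b \<in> {0..1}" for b
      using T_eq[OF p(1,2) tri[of "1/2"] tri[OF that]] pp unfolding s_def by (auto simp: glued_def)
    have "s p ` {0..1} - {s p (1/2)} = s p ` ({0..1} - {1/2})"
    proof -
      have "f ` X - {f a} = f ` (X - {a})" if "\<And>b. b \<in> X \<Longrightarrow> f b = f a \<longleftrightarrow> b = a"
        for f :: "real \<Rightarrow> 'a" and X a
        using that by auto
      from this[of "{0..1}" "s p" "1/2"] show ?thesis
        using inj by simp
    qed
    also have "{0..1} - {1/2} = {0..<1/2} \<union> {1/2<..1::real}"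
      by auto
    finally have "s p ` {0..1} - {s p (1/2)} = s p ` {0..<1/2} \<union> s p ` {1/2<..1}"
      by (simp add: image_Un)
    moreover have "s p' ` {0..1} - {s p (1/2)} = s p' ` {0..1}"
      using other by force
    ultimately have "path_image (curve G e) - {s p (1/2)} =
        (s p ` {0..<1/2} \<union> s p' ` {0..1}) \<union> s p ` {1/2<..1}"
      unfolding img' by blast
    moreover have "connected \<dots>"
    proof (intro connected_Un)
      show "connected (s p ` {0..<1/2})" "connected (s p' ` {0..1})" "connected (s p ` {1/2<..1})"
        by (auto intro!: connected_continuous_image continuous_on_subset[OF conts[OF p(1)]] conts[OF p(2)])
      have "s p 0 = s p' 0"
        using w p T_disc unfolding s_def by simp
      then have "s p 0 \<in> s p ` {0..<1/2} \<inter> s p' ` {0..1}"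
        using imageI[of 0 "{0..<1/2}" "s p"] imageI[of 0 "{0..1}" "s p'"] by simp
      then show "s p ` {0..<1/2} \<inter> s p' ` {0..1} \<noteq> {}"
        by blast
      have "s p 1 = s p' 1"
        using T_eq[OF p(1,2) tri[of 1] tri[of 1]] p unfolding s_def by (simp add: glued_def)
      then have "s p 1 \<in> (s p ` {0..<1/2} \<union> s p' ` {0..1}) \<inter> s p ` {1/2<..1}"
        using imageI[of 1 "{1/2<..1}" "s p"] imageI[of 1 "{0..1}" "s p'"] by simp
      then show "(s p ` {0..<1/2} \<union> s p' ` {0..1}) \<inter> s p ` {1/2<..1} \<noteq> {}"
        by blast
    qed
    moreover have "s p (1/2) \<noteq> w"
      using inj[of 0] w[OF p(5)] T_disc[OF p(1)] unfolding s_def by simp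
    moreover have "s p (1/2) \<in> path_image (curve G e)"
      unfolding img' by auto
    ultimately show ?thesis
      using pp(4) by (intro exI[of _ "s p (1/2)"]) simp
  qed
  have "s q (1/2) \<noteq> s (side R q) (1/2)"
    using T_eq[OF q'(1) _ tri[of "1/2"] tri[of "1/2"], of "side R q"] opp
    unfolding s_def glued_def by (auto simp: corners_on_def)
  then have "s q (1/2) \<noteq> v \<or> s (side R q) (1/2) \<noteq> v"
    by auto
  then show thesis
    using found[of q "side R q"] found[of "side R q" q] opp opp' that by (metis insert_commute)
qed

text \<open>
  Otherwise an edge ending at \<open>v\<close> has all its corners on the disc at the other end \<open>w\<close>.  Since
  \<open>v \<noteq> w\<close> it is an arc, but its image is a circle.
\<close>

lemma vertex_has_corner:
  assumes v: "v \<in> points G"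
  shows "v \<in> disc_of R ` corners R"
proof (rule ccontr)
  assume no: "v \<notin> disc_of R ` corners R"
  obtain e where e: "e \<in> lines G" "v \<in> {pathstart (curve G e), pathfinish (curve G e)}"
    using vertex_has_edge[OF v] by blast
  let ?g = "curve G e"
  have "card (corners_on R {e}) = 4"
    using rg(12) bands e by simp
  then obtain q where q: "q \<in> corners_on R {e}"
    by (metis all_not_in_conv card.empty zero_neq_numeral)
  define w where "w = disc_of R q"
  have disc: "disc_of R p \<in> {pathstart ?g, pathfinish ?g} - {v}" if "p \<in> corners_on R {e}" for p
    using incident_disc_is_end[OF e(1) that] no that by (auto simp: corners_on_def)
  then have w: "disc_of R p = w" if "p \<in> corners_on R {e}" for p
    using disc[OF that] disc[OF q] e(2) unfolding w_def by auto
  have vw: "{pathstart ?g, pathfinish ?g} = {v, w}" "v \<noteq> w"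
    using disc[OF q] e(2) unfolding w_def by auto
  obtain m where m: "m \<in> path_image ?g" "m \<noteq> v" "m \<noteq> w" "connected (path_image ?g - {m})"
    using loop_minus_point_connected[OF e(1) q w] by blast
  obtain t where t: "t \<in> {0..1}" "m = ?g t"
    using m(1) unfolding path_image_def by blast
  have "t \<noteq> 0" "t \<noteq> 1"
    using m(2,3) t(2) vw(1) unfolding pathstart_def pathfinish_def by (metis insert_iff singletonD)+
  moreover have "arc ?g"
  proof -
    have "simple_path ?g"
      using G e(1) unfolding embedded_def by simp
    moreover have "pathstart ?g \<noteq> pathfinish ?g"
      using vw by auto
    ultimately show ?thesis
      by (simp add: arc_simple_path)
  qed
  ultimately show False
    using arc_minus_inner_point_disconnected[of ?g t] t m(4) by auto
qed

lemma points_G: "points G = (\<lambda>q. T q (1, 0, 0)) ` corners R"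
  using vertex_has_corner rg(11) discs T_disc by auto

lemma off_carrier:
  assumes "q \<in> corners R" "(a, b, c) \<in> triangle" "c \<noteq> 0"
  shows "T q (a, b, c) \<notin> carrier G"
proof -
  have "T q (a, b, c) \<noteq> T p (a', b', 0)" if "p \<in> corners R" "(a', b', 0) \<in> triangle" for p a' b'
    using T_eq[OF assms(1) that(1) assms(2) that(2)] assms(3) by simp
  moreover have "(1, 0, 0) \<in> triangle"
    by (simp add: triangle_simps)
  ultimately show ?thesis
    unfolding carrier_def using points_G edge_image by (auto simp: corners_on_def)
qed

text \<open>
  A triangle without its edge side is connected and contains its face corner, which is a vertex of
  \<open>G'\<close>.  So each face of \<open>G\<close> contains such a corner, and this is the only vertex of \<open>G'\<close> in it.
\<close>

lemma points_G': "points G' = (\<lambda>q. T q (0, 0, 1)) ` corners R"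
proof
  show "(\<lambda>q. T q (0, 0, 1)) ` corners R \<subseteq> points G'"
    using T_face by auto
  show "points G' \<subseteq> (\<lambda>q. T q (0, 0, 1)) ` corners R"
  proof
    fix v assume v: "v \<in> points G'"
    then obtain F where F: "F \<in> regions S G" "v \<in> F"
      using dual unfolding region_dual_def by blast
    then have vS: "v \<in> S - carrier G"
      unfolding regions_def using in_components_subset by blast
    then obtain q a b c where q: "q \<in> corners R" "(a, b, c) \<in> triangle" "v = T q (a, b, c)"
      unfolding cover by auto
    have e: "label R q \<in> lines G"
      using rg(10)[OF q(1)] bands by simp
    have "c \<noteq> 0"
    proof
      assume "c = 0"
      then have "v \<in> path_image (curve G (label R q))"
        unfolding edge_image[OF e] using q by (auto simp: corners_on_def)
      then show False
        using vS e unfolding carrier_def by blast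
    qed
    define Z where "Z = closed_segment (a, b, c) (0, 0, 1)"
    have Z: "z \<in> triangle \<and> snd (snd z) \<noteq> 0" if zZ: "z \<in> Z" for z
    proof -
      obtain u where u: "0 \<le> u" "u \<le> 1" "z = (1 - u) *\<^sub>R (a, b, c) + u *\<^sub>R (0, 0, 1)"
        using zZ unfolding Z_def closed_segment_def by auto
      have abc: "a \<ge> 0" "b \<ge> 0" "c > 0" "c = 1 - a - b"
        using q(2) \<open>c \<noteq> 0\<close> by (auto simp: triangle_simps)
      have "(1 - u) * c + u > 0"
        using u(1,2) abc(3) by (cases "u = 0") (auto intro!: add_nonneg_pos)
      moreover have "(1 - u) * a + (1 - u) * b + ((1 - u) * c + u) = 1"
        unfolding abc(4) by (simp add: algebra_simps)
      ultimately show ?thesis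
        using u abc by (simp add: triangle_simps)
    qed
    have "connected (T q ` Z)"
      using Z unfolding Z_def
      by (intro connected_continuous_image continuous_on_subset[OF cont[OF q(1)]]) auto
    moreover have "T q ` Z \<subseteq> S - carrier G"
      using Z off_carrier[OF q(1)] q(1) unfolding cover by fastforce
    moreover have mem: "T q (a, b, c) \<in> T q ` Z" "T q (0, 0, 1) \<in> T q ` Z"
      by (auto simp: Z_def)
    moreover have "F \<inter> T q ` Z \<noteq> {}"
      using mem(1) F(2) q(3) by auto
    ultimately have "T q ` Z \<subseteq> F"
      using components_maximal F(1) unfolding regions_def by metis
    then have "T q (0, 0, 1) \<in> points G' \<inter> F" "v \<in> points G' \<inter> F"
      using mem T_face[OF q(1)] v F(2) by auto
    moreover have "\<exists>!u. u \<in> points G' \<inter> F"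
      using dual F(1) unfolding region_dual_def by blast
    ultimately have "v = T q (0, 0, 1)"
      by blast
    then show "v \<in> (\<lambda>q. T q (0, 0, 1)) ` corners R"
      using q(1) by blast
  qed
qed

definition cutting_graph :: "'e set \<Rightarrow> ('a, 'e + 'e) drawing" where
  "cutting_graph A = delete_lines (immersed_union G G') (Inl ` (lines G - A) \<union> Inr ` A)"

lemma cutting_graph_simps:
  assumes "A \<subseteq> lines G"
  shows "points (cutting_graph A) = points G \<union> points G'"
    "lines (cutting_graph A) = Inl ` A \<union> Inr ` (lines G - A)"
    "curve (cutting_graph A) = case_sum (curve G) (curve G')"
  using assms lines_G' by (auto simp: cutting_graph_def delete_lines_def immersed_union_def)

lemma cutting_edge_image:
  assumes "A \<subseteq> lines G" "l \<in> lines (cutting_graph A)"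
  shows "path_image (curve (cutting_graph A) l) =
    (\<Union>p\<in>corners_on R {case_sum id id l}. T p ` {y \<in> triangle. on_wall R A p y})"
proof -
  have wall: "{y \<in> triangle. on_wall R A p y} =
      (if label R p \<in> A then {(a, b, c). (a, b, c) \<in> triangle \<and> c = 0}
       else {(a, b, c). (a, b, c) \<in> triangle \<and> a = 0})" for p
    by (auto simp: on_wall_def)
  consider e where "e \<in> A" "l = Inl e" | e where "e \<in> lines G - A" "l = Inr e"
    using assms(2) unfolding cutting_graph_simps[OF assms(1)] by auto
  then show ?thesis
  proof cases
    case 1
    then have "e \<in> lines G"
      using assms(1) by blast
    with 1 show ?thesis
      unfolding cutting_graph_simps[OF assms(1)] wall by (simp add: edge_image corners_on_def)
  next
    case 2
    then show ?thesis
      unfolding cutting_graph_simps[OF assms(1)] wall by (simp add: dual_edge_image corners_on_def)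
  qed
qed

text \<open>
  On each triangle \<open>(G \<union> G\<^sup>*) - (A\<^sup>c \<union> A\<^sup>*)\<close> is one side and the opposite corner.  A point of an edge
  that is given on one triangle may have to be found on another one; the two then have the same
  label.
\<close>

lemma mem_cutting_carrier:
  assumes A: "A \<subseteq> lines G" and q: "q \<in> corners R" and x: "x \<in> triangle"
  shows "T q x \<in> carrier (cutting_graph A) \<longleftrightarrow> cut R A q x"
proof
  assume "cut R A q x"
  moreover have "T q x \<in> carrier (cutting_graph A)" if "on_wall R A q x"
  proof -
    define l where "l = (if label R q \<in> A then Inl (label R q) else Inr (label R q))"
    have l: "l \<in> lines (cutting_graph A)" "case_sum id id l = label R q"
      using rg(10)[OF q] bands unfolding l_def cutting_graph_simps[OF A] by auto
    have "T q x \<in> path_image (curve (cutting_graph A) l)"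
      unfolding cutting_edge_image[OF A l(1)] l(2) using q x that by (auto simp: corners_on_def)
    with l(1) show ?thesis
      unfolding carrier_def by blast
  qed
  ultimately show "T q x \<in> carrier (cutting_graph A)"
    unfolding cut_def carrier_def cutting_graph_simps[OF A] points_G points_G' using q by blast
next
  assume "T q x \<in> carrier (cutting_graph A)"
  then consider "T q x \<in> points G" | "T q x \<in> points G'"
    | l where "l \<in> lines (cutting_graph A)" "T q x \<in> path_image (curve (cutting_graph A) l)"
    unfolding carrier_def cutting_graph_simps(1)[OF A] by blast
  then show "cut R A q x"
  proof cases
    case 1
    then obtain p where "p \<in> corners R" "T q x = T p (1, 0, 0)"
      unfolding points_G by blast
    then show ?thesis
      using T_eq[OF q _ x, of p "(1, 0, 0)"] by (simp add: cut_def triangle_simps)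
  next
    case 2
    then obtain p where "p \<in> corners R" "T q x = T p (0, 0, 1)"
      unfolding points_G' by blast
    then show ?thesis
      using T_eq[OF q _ x, of p "(0, 0, 1)"] by (simp add: cut_def triangle_simps)
  next
    case 3
    then obtain p y where p: "p \<in> corners R" "y \<in> triangle" "on_wall R A p y" "T p y = T q x"
      unfolding cutting_edge_image[OF A 3(1)] corners_on_def by force
    then have "y = x" "glued R p q x"
      using T_eq[OF p(1) q p(2) x] by auto
    then have "label R q = label R p" if "x \<noteq> (1, 0, 0)" "x \<noteq> (0, 0, 1)"
      using glued_wall_label[OF ribbon p(1,2,3)] that by blast
    then have "on_wall R A q x" if "x \<noteq> (1, 0, 0)" "x \<noteq> (0, 0, 1)"
      using p(3) \<open>y = x\<close> that unfolding on_wall_def by simp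
    then show ?thesis
      unfolding cut_def by blast
  qed
qed

lemma inner_not_vertex:
  assumes A: "A \<subseteq> lines G" and l: "l \<in> lines (cutting_graph A)"
    and x: "T q x \<in> inner (curve (cutting_graph A) l)"
    and q: "q \<in> corners_on R {case_sum id id l}" "x \<in> triangle" "on_wall R A q x"
  shows "x \<noteq> (1, 0, 0)" "x \<noteq> (0, 0, 1)"
proof -
  have cor: "q \<in> corners R" "label R q = case_sum id id l"
    using q(1) by (auto simp: corners_on_def)
  have pts: "T q (1, 0, 0) \<in> points G" "T q (0, 0, 1) \<in> points G'"
    using cor(1) unfolding points_G points_G' by auto
  consider e where "e \<in> A" "l = Inl e" | e where "e \<in> lines G - A" "l = Inr e"
    using l unfolding cutting_graph_simps[OF A] by auto
  then have "x \<noteq> (1, 0, 0) \<and> x \<noteq> (0, 0, 1)"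
  proof cases
    case 1
    then have "inner (curve G e) \<inter> points G = {}"
      using G A unfolding embedded_def by blast
    then show ?thesis
      using 1 x q(3) cor pts(1) unfolding cutting_graph_simps[OF A] on_wall_def by auto
  next
    case 2
    then have "inner (curve G' e) \<inter> points G' = {}"
      using G' lines_G' unfolding embedded_def by blast
    then show ?thesis
      using 2 x q(3) cor pts(2) unfolding cutting_graph_simps[OF A] on_wall_def by auto
  qed
  then show "x \<noteq> (1, 0, 0)" "x \<noteq> (0, 0, 1)" by auto
qed

end

section \<open>The underlying graph of the partial dual\<close>

text \<open>
  The boundary of the ribbon graph on \<open>A\<close> runs along the sides of edge discs in \<open>A\<close> and along the
  arrows that replace the other edges, so it is traced by \<open>open_side\<close> and \<open>gap\<close>.
\<close>

lemma underlying_partial_dual: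
  assumes "A \<subseteq> bands R"
  shows "underlying_graph (partial_dual R A D) =
    \<lparr>verts = circle (open_side R A) (gap R) ` corners R <+> (discs R - disc_of R ` corners R),
     edges = bands R,
     ends = (\<lambda>e. Inl ` circle (open_side R A) (gap R) ` corners_on R {e})\<rparr>"
proof -
  let ?R = "arrow_delete R (bands R - A) D"
  have "bands R - (bands R - A) = A"
    using assms by blast
  then have "bside ?R = open_side R A" "bands ?R = A"
    using assms by (auto simp: bside_def open_side_def arrow_delete_def fun_eq_iff)
  then show ?thesis
    using assms
    by (auto simp: underlying_graph_def partial_dual_def arrow_add_def ribbon_dual_def
        boundary_components_def corners_on_def image_image arrow_delete_def Un_absorb1)
qed

section \<open>Graphs without edges\<close>

lemma connected_ball_minus_point:
  assumes "U homeomorphic (ball 0 1 :: complex set)" "p \<in> U"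
  shows "connected (U - {p})" "U - {p} \<noteq> {}"
proof -
  obtain h k where hom: "homeomorphism U (ball 0 1 :: complex set) h k"
    using assms(1) unfolding homeomorphic_def by blast
  have h: "h ` U = ball 0 1" "inj_on h U"
    using hom unfolding homeomorphism_def by (auto intro: inj_on_inverseI)
  then have img: "h ` (U - {p}) = ball 0 1 - {h p}"
    using assms(2) by (auto simp: inj_on_image_set_diff)
  then have "(U - {p}) homeomorphic (ball 0 1 - {h p})"
    using homeomorphism_of_subsets[OF hom, of "U - {p}" "ball 0 1 - {h p}"]
    unfolding homeomorphic_def by blast
  moreover have "connected (ball 0 1 - {h p})"
    by (rule connected_punctured_convex) (simp_all add: aff_dim_open)
  ultimately show "connected (U - {p})"
    using homeomorphic_connectedness by blast
  have "0 \<in> ball (0::complex) 1" "1/2 \<in> ball (0::complex) 1" "(0::complex) \<noteq> 1/2"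
    by auto
  then show "U - {p} \<noteq> {}"
    using img by (metis Diff_iff empty_iff image_empty singletonD)
qed

text \<open>
  A component of \<open>S - {p}\<close> that avoids a neighbourhood of \<open>p\<close> is compact, and an open disc is not.
  So every component meets, and hence contains, a punctured disc around \<open>p\<close>.
\<close>

lemma surface_minus_vertex:
  assumes S: "surface S" and p: "p \<in> S"
    and discs: "\<And>F. F \<in> components (S - {p}) \<Longrightarrow> F homeomorphic (ball 0 1 :: complex set)"
  shows "components (S - {p}) = {S - {p}}"
proof -
  obtain U where U: "openin (top_of_set S) U" "p \<in> U" "U homeomorphic (ball 0 1 :: complex set)"
    using S p unfolding surface_def by blast
  note conn = connected_ball_minus_point[OF U(3,2)]
  have "U - {p} \<subseteq> F" if F: "F \<in> components (S - {p})" for F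
  proof -
    have "F \<inter> (U - {p}) \<noteq> {}"
    proof
      assume "F \<inter> (U - {p}) = {}"
      moreover have FS: "F \<subseteq> S - {p}"
        using F by (rule in_components_subset)
      moreover obtain K where "closed K" "F = (S - {p}) \<inter> K"
        using closedin_component[OF F] by (auto simp: closedin_closed)
      moreover obtain W where "open W" "U = S \<inter> W"
        using U(1) by (auto simp: openin_open)
      ultimately have "F = S \<inter> (K \<inter> - W)"
        using U(2) by blast
      then have "compact F"
        using S \<open>closed K\<close> \<open>open W\<close> by (simp add: surface_def compact_Int_closed closed_Int closed_Compl)
      then have "compact (ball 0 1 :: complex set)"
        using homeomorphic_compactness[OF discs[OF F]] by simp
      then show False
        using compact_imp_closed clopen[of "ball 0 1 :: complex set"] not_bounded_UNIV bounded_ball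
        by (metis ball_eq_empty not_one_le_zero open_ball)
    qed
    moreover have "U - {p} \<subseteq> S - {p}"
      using openin_imp_subset[OF U(1)] by blast
    ultimately show ?thesis
      using components_maximal[OF F conn(1)] by blast
  qed
  then have "F = F'" if "F \<in> components (S - {p})" "F' \<in> components (S - {p})" for F F'
    using components_eq[OF that] that conn(2) by blast
  then have "connected (S - {p})"
    unfolding connected_eq_connected_components_eq by blast
  moreover have "S - {p} \<noteq> {}"
    using conn(2) openin_imp_subset[OF U(1)] by blast
  ultimately show ?thesis
    by (simp add: components_eq_sing_iff)
qed

text \<open>
  \<open>G\<close> is a single vertex, its complement one open disc, and removing the only vertex of \<open>G'\<close> from
  this disc leaves it connected.
\<close>

lemma edgeless_case:
  assumes S: "surface S" and G: "cellularly_embedded S G"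
    and connected: "connected_graph (abstract_graph G)"
    and dual: "region_dual S G G'" and no_edges: "lines G = {}"
    and K: "region_dual S (delete_lines (immersed_union G G') X) K"
  shows "lines K = {}" and "\<exists>p k. points G = {p} \<and> points K = {k}"
proof -
  have lines: "lines G' = {}"
    using dual no_edges by (simp add: region_dual_def)
  show "lines K = {}"
    using K no_edges lines by (auto simp: region_dual_def delete_lines_def immersed_union_def)
  obtain p where p: "points G = {p}"
    using connected no_edges unfolding connected_graph_def abstract_graph_def
    by auto
  have "p \<in> S"
    using G p by (simp add: cellularly_embedded_def embedded_def)
  have "regions S G = components (S - {p})"
    using p no_edges by (simp add: regions_def carrier_def)
  then have reg: "regions S G = {S - {p}}" and ball: "(S - {p}) homeomorphic (ball 0 1 :: complex set)"
    using surface_minus_vertex[OF S \<open>p \<in> S\<close>] G unfolding cellularly_embedded_def by auto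
  then have "points G' \<subseteq> S - {p}" "\<exists>!v. v \<in> points G' \<inter> (S - {p})"
    using dual unfolding region_dual_def by auto
  then obtain v where v: "points G' = {v}" "v \<in> S - {p}"
    by (auto simp: Int_absorb2)
  let ?H = "delete_lines (immersed_union G G') X"
  have "carrier ?H = {p, v}"
    using p v no_edges lines by (auto simp: carrier_def delete_lines_def immersed_union_def)
  then have "regions S ?H = components (S - {p} - {v})"
    by (simp add: regions_def Diff_insert2[symmetric] insert_commute)
  also have "\<dots> = {S - {p} - {v}}"
    unfolding components_eq_sing_iff using connected_ball_minus_point[OF ball v(2)] by (rule conjI)
  finally have "points K \<subseteq> S - {p} - {v}" "\<exists>!k. k \<in> points K \<inter> (S - {p} - {v})"
    using K unfolding region_dual_def by auto
  then obtain k where "points K = {k}"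
    by (auto simp: Int_absorb2)
  with p show "\<exists>p k. points G = {p} \<and> points K = {k}"
    by blast
qed

section \<open>The dual of the cut graph and the partial dual\<close>

lemma (in barycentric_subdivision) partial_dual_graph_iso:
  assumes A: "A \<subseteq> lines G" and K: "region_dual S (cutting_graph A) K"
  shows "graph_iso (abstract_graph K) (underlying_graph (partial_dual R A D))"
proof -
  let ?H = "cutting_graph A" and ?N = "carrier (cutting_graph A)"
  interpret dissected_surface S R T A ?N
    using ribbon cont cover T_eq mem_cutting_carrier[OF A] by unfold_locales auto
  have comp: "regions S ?H = components (S - ?N)"
    by (simp add: regions_def)
  have K': "points K \<subseteq> \<Union>(components (S - ?N))" "\<And>F. F \<in> components (S - ?N) \<Longrightarrow> \<exists>!v. v \<in> points K \<inter> F"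
    "lines K = lines ?H" "embedded S K"
    using K unfolding region_dual_def comp by auto
  have off: "points K \<subseteq> S - ?N"
    using K'(1) by (simp add: Union_components)
  have "bij_betw orbit_at (points K) (orb ` corners R)"
    by (rule representatives_bij[OF K'(1,2)])
  moreover have "bij_betw Inl (orb ` corners R) (Inl ` orb ` corners R)"
    by (simp add: inj_on_imp_bij_betw)
  moreover have "orb ` corners R <+> (discs R - disc_of R ` corners R) = Inl ` orb ` corners R"
    using vertex_has_corner discs by auto
  ultimately have verts: "bij_betw (Inl \<circ> orbit_at) (points K)
      (orb ` corners R <+> (discs R - disc_of R ` corners R))"
    using bij_betw_trans by metis
  have edges: "bij_betw (case_sum id id) (lines K) (bands R)"
    unfolding bij_betw_def
  proof
    show "inj_on (case_sum id id) (lines K)"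
      unfolding K'(3) cutting_graph_simps[OF A] by (auto simp: inj_on_def)
    show "case_sum id id ` lines K = bands R"
      unfolding K'(3) cutting_graph_simps[OF A] bands image_Un image_image using A by auto
  qed
  have ends: "(Inl \<circ> orbit_at) ` {pathstart (curve K l), pathfinish (curve K l)} =
      Inl ` orb ` corners_on R {case_sum id id l}" if "l \<in> lines K" for l
  proof -
    have l: "l \<in> lines ?H"
      using that K'(3) by simp
    let ?e = "case_sum id id l"
    obtain x where x: "x \<in> inner (curve ?H l)" "path_image (curve K l) \<inter> ?N = {x}"
      "cross_at S (path_image (curve ?H l)) (path_image (curve K l)) x"
      using K l unfolding region_dual_def by blast
    have wall: "path_image (curve ?H l) = wall ?e"
      unfolding wall_def by (rule cutting_edge_image[OF A l])
    have "inner (curve ?H l) \<subseteq> wall ?e"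
      unfolding wall[symmetric] inner_def path_image_def by (rule image_mono) auto
    then have "x \<in> wall ?e"
      using x(1) by (rule subsetD)
    then obtain q y where q: "q \<in> corners_on R {?e}" "y \<in> triangle" "on_wall R A q y" "x = T q y"
      unfolding wall_def by blast
    have cor: "q \<in> corners R" "label R q = ?e"
      using q(1) by (auto simp: corners_on_def)
    have y: "y \<noteq> (1, 0, 0)" "y \<noteq> (0, 0, 1)"
      using inner_not_vertex[OF A l _ q(1-3)] x(1) q(4) by auto
    have k: "simple_path (curve K l)" "path_image (curve K l) \<subseteq> S"
      "pathstart (curve K l) \<in> points K" "pathfinish (curve K l) \<in> points K"
      using K'(4) that unfolding embedded_def by auto
    have "{orbit_at (pathstart (curve K l)), orbit_at (pathfinish (curve K l))} = orb ` corners_on R {label R q}"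
    proof (rule crossing_ends[OF cor(1) q(2,3) y k(1,2)])
      show "path_image (curve K l) \<inter> ?N = {T q y}" "cross_at S (wall (label R q)) (path_image (curve K l)) (T q y)"
        using x(2,3) q(4) wall cor(2) by auto
      show "pathstart (curve K l) \<notin> ?N" "pathfinish (curve K l) \<notin> ?N"
        using k(3,4) off by auto
    qed
    then have "Inl ` {orbit_at (pathstart (curve K l)), orbit_at (pathfinish (curve K l))} = Inl ` orb ` corners_on R {?e}"
      using cor(2) by simp
    then show ?thesis by simp
  qed
  show ?thesis
    unfolding graph_iso_def underlying_partial_dual[OF A[folded bands]] abstract_graph_def graph.select_convs
    by (intro exI[of _ "Inl \<circ> orbit_at"] exI[of _ "case_sum id id"] conjI ballI verts edges)
      (rule ends[symmetric])
qed

theorem theorem5: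
  fixes S :: "'a::t2_space set"
    and G G' :: "('a, 'e) drawing"
    and R :: "('a, 'e, 'q) ribbon"
    and A :: "'e set" and D :: "'q set"
    and K :: "('a, 'e + 'e) drawing"
  assumes "surface S"
    and "cellularly_embedded S G" and "connected_graph (abstract_graph G)"
    and "region_dual S G G'"
    and "ribbon_graph_of S G G' R"
    and "A \<subseteq> lines G"
    and "boundary_orientation R (lines G - A) D"
    and "region_dual S
           (delete_lines (immersed_union G G') (Inl ` (lines G - A) \<union> Inr ` A)) K"
  shows "graph_iso (abstract_graph K) (underlying_graph (partial_dual R A D))"
proof -
  have R: "ribbon_graph R" "discs R = points G" "bands R = lines G"
    using assms(5) unfolding ribbon_graph_of_def by auto
  show ?thesis
  proof (cases "corners R = {}")
    case True
    have "card (corners_on R {e}) = 0" for e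
      using True by (simp add: corners_on_def)
    then have "lines G = {}"
      using ribbon_graphD(12)[OF R(1)] R(3) by fastforce
    note edgeless = edgeless_case[OF assms(1-4) this assms(8)]
    obtain p k where "points G = {p}" "points K = {k}"
      using edgeless(2) by blast
    then show ?thesis
      using True R \<open>lines G = {}\<close> assms(6) edgeless(1)
      unfolding graph_iso_def underlying_partial_dual[OF assms(6)[folded R(3)]] abstract_graph_def
      by (intro exI[of _ "\<lambda>_. Inr p"]) (auto simp: bij_betw_def)
  next
    case False
    obtain T :: "'q \<Rightarrow> real \<times> real \<times> real \<Rightarrow> 'a" where
      T: "\<forall>q\<in>corners R. continuous_on triangle (T q) \<and> T q ` triangle \<subseteq> S"
        "S = (\<Union>q\<in>corners R. T q ` triangle)"
        "\<forall>p\<in>corners R. \<forall>q\<in>corners R. \<forall>x\<in>triangle. \<forall>y\<in>triangle.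
           T p x = T q y \<longleftrightarrow> x = y \<and> glued R p q x"
        "\<forall>q\<in>corners R. T q (1, 0, 0) = disc_of R q \<and> T q (0, 0, 1) \<in> points G'"
        "\<forall>e\<in>lines G.
           path_image (curve G e) =
             (\<Union>q\<in>corners_on R {e}. T q ` {(a, b, c) \<in> triangle. c = 0}) \<and>
           path_image (curve G' e) =
             (\<Union>q\<in>corners_on R {e}. T q ` {(a, b, c) \<in> triangle. a = 0})"
      using assms(5) False unfolding ribbon_graph_of_def by blast
    have "embedded S G"
      using assms(2) by (simp add: cellularly_embedded_def)
    then have "barycentric_subdivision S G G' R T"
      using assms(3,4) R False T(1,3-5) by unfold_locales (simp_all, rule T(2))
    then interpret barycentric_subdivision S G G' R T .
    show ?thesis
      using partial_dual_graph_iso[OF assms(6)] assms(8) by (simp add: cutting_graph_def)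
  qed
qed

end
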